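(* Abnormal extremals of the $(2,3,5,8)$ sub-Riemannian problem are reparameterizations of curves $\lambda(t)\in T^*G$ that satisfy the conditions \begin{align*} &h_1(\lambda(t))=h_2(\lambda(t))=h_3(\lambda(t))=0,\\ &\begin{pmatrix}\dot h_4\\ \dot h_5\end{pmatrix}=D\begin{pmatrix}h_4\\ h_5\end{pmatrix},\qquad D=\begin{pmatrix}h_7&-h_6\\ h_8&-h_7\end{pmatrix},\\ &\dot h_6=\dot h_7=\dot h_8=0,\\ &\dot q=-h_5X_1+h_4X_2. \end{align*}
   Context: $G$ is the connected simply connected Lie group whose Lie algebra has a basis of left-invariant vector fields $X_1,\dots,X_8$ with brackets $[X_1,X_2]=X_3$, $[X_1,X_3]=X_4$, $[X_2,X_3]=X_5$, $[X_1,X_4]=X_6$, $[X_1,X_5]=[X_2,X_4]=X_7$, $[X_2,X_5]=X_8$, all other brackets $[X_i,X_j]$ with $i<j$ being zero. The $(2,3,5,8)$ sub-Riemannian problem is the optimal control problem $$\dot q=u_1X_1(q)+u_2X_2(q),\quad q\in G,\ (u_1,u_2)\in\mathbb{R}^2,\quad q(0)=q_0,\ q(t_1)=q_1,\quad \tfrac12\int_0^{t_1}(u_1^2+u_2^2)\,dt\to\min .$$ On $T^*G$ put $h_i(\lambda)=\langle\lambda,X_i\rangle$, $i=1,\dots,8$, and use the parametrization $\lambda=(h_1,\dots,h_8,q)$. An abnormal extremal is a Lipschitzian curve $\lambda(t)\in T^*G$, $t\in[0,t_1]$, satisfying, for some control $u(t)=(u_1(t),u_2(t))$, the conditions of the Pontryagin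 Maximum Principle with $\nu=0$: - for a.e. $t$, the Hamiltonian system with the Hamiltonian $u_1(t)h_1+u_2(t)h_2$, which reads $\dot h_1=-u_2h_3$, $\dot h_2=u_1h_3$, $\dot h_3=u_1h_4+u_2h_5$, $\dot h_4=u_1h_6+u_2h_7$, $\dot h_5=u_1h_7+u_2h_8$, $\dot h_6=\dot h_7=\dot h_8=0$, $\dot q=u_1X_1+u_2X_2$; - the maximality condition $u_1(t)h_1(\lambda(t))+u_2(t)h_2(\lambda(t))=\max_{v\in\mathbb{R}^2}\big(v_1h_1(\lambda(t))+v_2h_2(\lambda(t))\big)$ for all $t$; - the nontriviality condition $\lambda(t)\neq0$ for all $t$. Trajectories are taken non-constant and parametrized with constant velocity, i.e. $u_1^2+u_2^2\equiv\mathrm{const}\neq0$.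
   Formalization: Claimed on closed time intervals where (h4,h5) is nonzero, since extremals through h4=h5=0 are not such reparameterizations; the parameter change may be non-monotone because the control may switch sign; where h4=h5=0 identically, the trajectory is lifted with other h4,h5. *)

theory Defs
  imports "HOL-Analysis.Analysis"
begin

lemma exhaust_8:
  fixes x :: 8
  shows "x = 1 \<or> x = 2 \<or> x = 3 \<or> x = 4 \<or> x = 5 \<or> x = 6 \<or> x = 7 \<or> x = 8"
proof (induct x)
  case (of_int z)
  then have "z = 0 \<or> z = 1 \<or> z = 2 \<or> z = 3 \<or> z = 4 \<or> z = 5 \<or> z = 6 \<or> z = 7" by fastforce
  then show ?case by auto
qed

lemma forall_8:
  "(\<forall>i::8. P i) \<longleftrightarrow> P 1 \<and> P 2 \<and> P 3 \<and> P 4 \<and> P 5 \<and> P 6 \<and> P 7 \<and> P 8"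
  by (metis exhaust_8)

lemma vector_8 [simp]:
  fixes a b c d e f g k :: "'a::zero"
  shows "(vector [a, b, c, d, e, f, g, k] :: 'a^8) $ 1 = a"
    and "(vector [a, b, c, d, e, f, g, k] :: 'a^8) $ 2 = b"
    and "(vector [a, b, c, d, e, f, g, k] :: 'a^8) $ 3 = c"
    and "(vector [a, b, c, d, e, f, g, k] :: 'a^8) $ 4 = d"
    and "(vector [a, b, c, d, e, f, g, k] :: 'a^8) $ 5 = e"
    and "(vector [a, b, c, d, e, f, g, k] :: 'a^8) $ 6 = f"
    and "(vector [a, b, c, d, e, f, g, k] :: 'a^8) $ 7 = g"
    and "(vector [a, b, c, d, e, f, g, k] :: 'a^8) $ 8 = k"
  unfolding vector_def by simp_all

lemma vec_eq_8: "(x :: 'a^8) = y \<longleftrightarrow> x$1 = y$1 \<and> x$2 = y$2 \<and> x$3 = y$3 \<and> x$4 = y$4 \<and>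
    x$5 = y$5 \<and> x$6 = y$6 \<and> x$7 = y$7 \<and> x$8 = y$8"
  by (simp add: vec_eq_iff forall_8)

lemma has_derivative_vector_8:
  fixes f1 f2 f3 f4 f5 f6 f7 f8 :: "'a::real_normed_vector \<Rightarrow> real"
  assumes "(f1 has_derivative g1) (at x within S)" "(f2 has_derivative g2) (at x within S)"
    "(f3 has_derivative g3) (at x within S)" "(f4 has_derivative g4) (at x within S)"
    "(f5 has_derivative g5) (at x within S)" "(f6 has_derivative g6) (at x within S)"
    "(f7 has_derivative g7) (at x within S)" "(f8 has_derivative g8) (at x within S)"
  shows "((\<lambda>y. vector [f1 y, f2 y, f3 y, f4 y, f5 y, f6 y, f7 y, f8 y] :: real^8) has_derivative
    (\<lambda>v. vector [g1 v, g2 v, g3 v, g4 v, g5 v, g6 v, g7 v, g8 v])) (at x within S)"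
proof -
  have 1: "vector [a1, a2, a3, a4, a5, a6, a7, a8] = axis 1 a1 + axis 2 a2 + axis 3 a3 + axis 4 a4
      + axis 5 a5 + axis 6 a6 + axis 7 a7 + (axis 8 a8 :: real^8)" for a1 a2 a3 a4 a5 a6 a7 a8 :: real
    by (simp add: vec_eq_8 axis_def)
  have 2: "bounded_linear (axis i :: real \<Rightarrow> real^8)" for i
    by (intro linear_conv_bounded_linear[THEN iffD1] linearI) (auto simp: axis_def vec_eq_iff)
  show ?thesis
    unfolding 1 by (intro has_derivative_add bounded_linear.has_derivative[OF 2] assms)
qed


section \<open>The group\<close>

text \<open>The Lie algebra of the statement is the free nilpotent one of rank 2 and step 4.  Its connected
  simply connected Lie group is realized on \<open>real^8\<close> with a polynomial product.  The lemmas below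
  verify that this is a group, that \<open>X1, \<dots>, X8\<close> form a left-invariant frame, and that they
  satisfy the prescribed bracket relations; these data determine the group up to isomorphism.\<close>

definition gmult :: "real^8 \<Rightarrow> real^8 \<Rightarrow> real^8" where
  "gmult x y = vector
    [x$1 + y$1,
     x$2 + y$2,
     x$3 + x$1 * y$2 + y$3,
     x$4 + (x$1)^2 / 2 * y$2 + x$1 * y$3 + y$4,
     x$5 + x$1 * x$2 * y$2 + x$1 * (y$2)^2 / 2 + x$2 * y$3 + y$5,
     x$6 + (x$1)^3 / 6 * y$2 + (x$1)^2 / 2 * y$3 + x$1 * y$4 + y$6,
     x$7 + (x$1)^2 * x$2 / 2 * y$2 + (x$1)^2 / 4 * (y$2)^2 + x$1 * x$2 * y$3
       + x$1 * y$5 + x$2 * y$4 + y$7,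
     x$8 + x$1 * (x$2)^2 / 2 * y$2 + x$1 * x$2 / 2 * (y$2)^2 + x$1 / 6 * (y$2)^3
       + (x$2)^2 / 2 * y$3 + x$2 * y$5 + y$8]"

definition X1 :: "real^8 \<Rightarrow> real^8" where
  "X1 x = vector [1, 0, 0, 0, 0, 0, 0, 0]"
definition X2 :: "real^8 \<Rightarrow> real^8" where
  "X2 x = vector [0, 1, x$1, (x$1)^2 / 2, x$1 * x$2, (x$1)^3 / 6, (x$1)^2 * x$2 / 2, x$1 * (x$2)^2 / 2]"
definition X3 :: "real^8 \<Rightarrow> real^8" where
  "X3 x = vector [0, 0, 1, x$1, x$2, (x$1)^2 / 2, x$1 * x$2, (x$2)^2 / 2]"
definition X4 :: "real^8 \<Rightarrow> real^8" where
  "X4 x = vector [0, 0, 0, 1, 0, x$1, x$2, 0]"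
definition X5 :: "real^8 \<Rightarrow> real^8" where
  "X5 x = vector [0, 0, 0, 0, 1, 0, x$1, x$2]"
definition X6 :: "real^8 \<Rightarrow> real^8" where
  "X6 x = vector [0, 0, 0, 0, 0, 1, 0, 0]"
definition X7 :: "real^8 \<Rightarrow> real^8" where
  "X7 x = vector [0, 0, 0, 0, 0, 0, 1, 0]"
definition X8 :: "real^8 \<Rightarrow> real^8" where
  "X8 x = vector [0, 0, 0, 0, 0, 0, 0, 1]"

lemmas X_defs = X1_def X2_def X3_def X4_def X5_def X6_def X7_def X8_def

lemma gmult_assoc: "gmult (gmult x y) z = gmult x (gmult y z)"
  by (simp add: gmult_def vec_eq_8 field_simps power2_eq_square power3_eq_cube)

lemma gmult_zero [simp]: "gmult 0 x = x" "gmult x 0 = x"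
  by (simp_all add: gmult_def vec_eq_8)

lemma gmult_right_inverse: "\<exists>y. gmult x y = 0"
proof -
  define y1 where "y1 = - x$1"
  define y2 where "y2 = - x$2"
  define y3 where "y3 = - (x$3 + x$1 * y2)"
  define y4 where "y4 = - (x$4 + (x$1)^2 / 2 * y2 + x$1 * y3)"
  define y5 where "y5 = - (x$5 + x$1 * x$2 * y2 + x$1 * y2^2 / 2 + x$2 * y3)"
  define y6 where "y6 = - (x$6 + (x$1)^3 / 6 * y2 + (x$1)^2 / 2 * y3 + x$1 * y4)"
  define y7 where "y7 = - (x$7 + (x$1)^2 * x$2 / 2 * y2 + (x$1)^2 / 4 * y2^2 + x$1 * x$2 * y3
       + x$1 * y5 + x$2 * y4)"
  define y8 where "y8 = - (x$8 + x$1 * (x$2)^2 / 2 * y2 + x$1 * x$2 / 2 * y2^2 + x$1 / 6 * y2^3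
       + (x$2)^2 / 2 * y3 + x$2 * y5)"
  have "gmult x (vector [y1, y2, y3, y4, y5, y6, y7, y8]) = 0"
    unfolding gmult_def vec_eq_8 vector_8 zero_index
    by (intro conjI; simp only: y1_def y2_def y3_def y4_def y5_def y6_def y7_def y8_def)
  then show ?thesis by blast
qed

lemma gmult_inverse: "\<exists>y. gmult x y = 0 \<and> gmult y x = 0"
proof -
  obtain y where y: "gmult x y = 0" using gmult_right_inverse by blast
  obtain z where z: "gmult y z = 0" using gmult_right_inverse by blast
  have "z = gmult (gmult x y) z" by (simp add: y)
  also have "\<dots> = x" by (simp add: gmult_assoc z)
  finally show ?thesis using y z by blast
qed

lemma X_at_zero:
  "X1 0 = axis 1 1" "X2 0 = axis 2 1" "X3 0 = axis 3 1" "X4 0 = axis 4 1"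
  "X5 0 = axis 5 1" "X6 0 = axis 6 1" "X7 0 = axis 7 1" "X8 0 = axis 8 1"
  by (simp_all add: X_defs vec_eq_8 axis_def)

lemma gmult_has_derivative:
  "(gmult x has_derivative (\<lambda>v. vector
    [v$1,
     v$2,
     x$1 * v$2 + v$3,
     (x$1)^2 / 2 * v$2 + x$1 * v$3 + v$4,
     x$1 * x$2 * v$2 + x$1 * y$2 * v$2 + x$2 * v$3 + v$5,
     (x$1)^3 / 6 * v$2 + (x$1)^2 / 2 * v$3 + x$1 * v$4 + v$6,
     (x$1)^2 * x$2 / 2 * v$2 + (x$1)^2 / 2 * y$2 * v$2 + x$1 * x$2 * v$3
       + x$1 * v$5 + x$2 * v$4 + v$7,
     x$1 * (x$2)^2 / 2 * v$2 + x$1 * x$2 * y$2 * v$2 + x$1 / 2 * (y$2)^2 * v$2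
       + (x$2)^2 / 2 * v$3 + x$2 * v$5 + v$8])) (at y)"
  unfolding gmult_def
  by (rule has_derivative_vector_8)
    (auto intro!: derivative_eq_intros bounded_linear.has_derivative[OF bounded_linear_vec_nth]
      ext simp: field_simps power2_eq_square)

lemma X_left_invariant:
  "frechet_derivative (gmult x) (at y) (X1 y) = X1 (gmult x y)"
  "frechet_derivative (gmult x) (at y) (X2 y) = X2 (gmult x y)"
  "frechet_derivative (gmult x) (at y) (X3 y) = X3 (gmult x y)"
  "frechet_derivative (gmult x) (at y) (X4 y) = X4 (gmult x y)"
  "frechet_derivative (gmult x) (at y) (X5 y) = X5 (gmult x y)"
  "frechet_derivative (gmult x) (at y) (X6 y) = X6 (gmult x y)"
  "frechet_derivative (gmult x) (at y) (X7 y) = X7 (gmult x y)"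
  "frechet_derivative (gmult x) (at y) (X8 y) = X8 (gmult x y)"
  unfolding frechet_derivative_at[OF gmult_has_derivative, symmetric]
  by (simp_all add: X_defs gmult_def vec_eq_8 field_simps power2_eq_square power3_eq_cube)

definition lie_bracket :: "(real^8 \<Rightarrow> real^8) \<Rightarrow> (real^8 \<Rightarrow> real^8) \<Rightarrow> real^8 \<Rightarrow> real^8" where
  "lie_bracket V W x =
     frechet_derivative W (at x) (V x) - frechet_derivative V (at x) (W x)"

lemma X_has_derivative:
  "(X1 has_derivative (\<lambda>v. vector [0, 0, 0, 0, 0, 0, 0, 0])) (at x)"
  "(X2 has_derivative (\<lambda>v. vector [0, 0, v$1, x$1 * v$1, x$2 * v$1 + x$1 * v$2, (x$1)^2 / 2 * v$1,
      x$1 * x$2 * v$1 + (x$1)^2 / 2 * v$2, (x$2)^2 / 2 * v$1 + x$1 * x$2 * v$2])) (at x)"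
  "(X3 has_derivative (\<lambda>v. vector [0, 0, 0, v$1, v$2, x$1 * v$1, x$2 * v$1 + x$1 * v$2,
      x$2 * v$2])) (at x)"
  "(X4 has_derivative (\<lambda>v. vector [0, 0, 0, 0, 0, v$1, v$2, 0])) (at x)"
  "(X5 has_derivative (\<lambda>v. vector [0, 0, 0, 0, 0, 0, v$1, v$2])) (at x)"
  "(X6 has_derivative (\<lambda>v. vector [0, 0, 0, 0, 0, 0, 0, 0])) (at x)"
  "(X7 has_derivative (\<lambda>v. vector [0, 0, 0, 0, 0, 0, 0, 0])) (at x)"
  "(X8 has_derivative (\<lambda>v. vector [0, 0, 0, 0, 0, 0, 0, 0])) (at x)"
  unfolding X_defs
  by (rule has_derivative_vector_8;
      auto intro!: derivative_eq_intros bounded_linear.has_derivative[OF bounded_linear_vec_nth]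
      ext simp: field_simps power2_eq_square)+

lemmas X_frechet_derivative = X_has_derivative[THEN frechet_derivative_at, symmetric]

lemma X_brackets:
  "lie_bracket X1 X2 = X3" "lie_bracket X1 X3 = X4" "lie_bracket X2 X3 = X5"
  "lie_bracket X1 X4 = X6" "lie_bracket X1 X5 = X7" "lie_bracket X2 X4 = X7"
  "lie_bracket X2 X5 = X8"
  by (simp_all add: fun_eq_iff lie_bracket_def X_frechet_derivative X_defs vec_eq_8 field_simps
      power2_eq_square power3_eq_cube)

lemma X_brackets_zero:
  "lie_bracket X1 X6 = (\<lambda>x. 0)" "lie_bracket X1 X7 = (\<lambda>x. 0)" "lie_bracket X1 X8 = (\<lambda>x. 0)"
  "lie_bracket X2 X6 = (\<lambda>x. 0)" "lie_bracket X2 X7 = (\<lambda>x. 0)" "lie_bracket X2 X8 = (\<lambda>x. 0)"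
  "lie_bracket X3 X4 = (\<lambda>x. 0)" "lie_bracket X3 X5 = (\<lambda>x. 0)" "lie_bracket X3 X6 = (\<lambda>x. 0)"
  "lie_bracket X3 X7 = (\<lambda>x. 0)" "lie_bracket X3 X8 = (\<lambda>x. 0)" "lie_bracket X4 X5 = (\<lambda>x. 0)"
  "lie_bracket X4 X6 = (\<lambda>x. 0)" "lie_bracket X4 X7 = (\<lambda>x. 0)" "lie_bracket X4 X8 = (\<lambda>x. 0)"
  "lie_bracket X5 X6 = (\<lambda>x. 0)" "lie_bracket X5 X7 = (\<lambda>x. 0)" "lie_bracket X5 X8 = (\<lambda>x. 0)"
  "lie_bracket X6 X7 = (\<lambda>x. 0)" "lie_bracket X6 X8 = (\<lambda>x. 0)" "lie_bracket X7 X8 = (\<lambda>x. 0)"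
  by (simp_all add: fun_eq_iff lie_bracket_def X_frechet_derivative X_defs vec_eq_8)


section \<open>Abnormal extremals\<close>

text \<open>The cotangent bundle is trivialized by the left-invariant frame: the pair \<open>(h, q)\<close> stands for
  the covector at \<open>q\<close> that takes the value \<open>h $ i\<close> on the \<open>i\<close>-th basis vector.\<close>

type_synonym cotangent = "(real^8) \<times> (real^8)"

definition h :: "8 \<Rightarrow> cotangent \<Rightarrow> real" where
  "h i l = fst l $ i"

definition hamiltonian_field :: "real \<Rightarrow> real \<Rightarrow> cotangent \<Rightarrow> cotangent" where
  "hamiltonian_field u1 u2 l =
    (vector [- u2 * h 3 l, u1 * h 3 l, u1 * h 4 l + u2 * h 5 l,
             u1 * h 6 l + u2 * h 7 l, u1 * h 7 l + u2 * h 8 l, 0, 0, 0],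
     u1 *\<^sub>R X1 (snd l) + u2 *\<^sub>R X2 (snd l))"

definition constant_velocity_control :: "real \<Rightarrow> (real \<Rightarrow> real) \<Rightarrow> (real \<Rightarrow> real) \<Rightarrow> bool" where
  "constant_velocity_control T u1 u2 \<longleftrightarrow>
     u1 \<in> borel_measurable (lebesgue_on {0..T}) \<and> u2 \<in> borel_measurable (lebesgue_on {0..T}) \<and>
     (\<exists>c. c \<noteq> 0 \<and> (\<forall>t\<in>{0..T}. (u1 t)^2 + (u2 t)^2 = c))"

definition constant_velocity_trajectory :: "real \<Rightarrow> (real \<Rightarrow> real^8) \<Rightarrow> bool" where
  "constant_velocity_trajectory T q \<longleftrightarrow>
     (\<exists>u1 u2. constant_velocity_control T u1 u2 \<and>
        (AE t in lebesgue_on {0..T}.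
           (q has_vector_derivative u1 t *\<^sub>R X1 (q t) + u2 t *\<^sub>R X2 (q t)) (at t within {0..T})))"

definition abnormal_extremal :: "real \<Rightarrow> (real \<Rightarrow> cotangent) \<Rightarrow> bool" where
  "abnormal_extremal T \<gamma> \<longleftrightarrow>
     0 < T \<and> (\<exists>L. L-lipschitz_on {0..T} \<gamma>) \<and>
     (\<exists>u1 u2. constant_velocity_control T u1 u2 \<and>
        (AE t in lebesgue_on {0..T}.
           (\<gamma> has_vector_derivative hamiltonian_field (u1 t) (u2 t) (\<gamma> t)) (at t within {0..T})) \<and>
        (\<forall>t\<in>{0..T}. \<forall>v1 v2.
           v1 * h 1 (\<gamma> t) + v2 * h 2 (\<gamma> t) \<le> u1 t * h 1 (\<gamma> t) + u2 t * h 2 (\<gamma> t))) \<and>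
     (\<forall>t\<in>{0..T}. fst (\<gamma> t) \<noteq> 0)"


section \<open>The reduced system and reparameterizations\<close>

definition D :: "cotangent \<Rightarrow> real^2^2" where
  "D l = vector [vector [h 7 l, - h 6 l], vector [h 8 l, - h 7 l]]"

definition reduced_curve :: "real set \<Rightarrow> (real \<Rightarrow> cotangent) \<Rightarrow> bool" where
  "reduced_curve S \<mu> \<longleftrightarrow> (\<forall>s\<in>S.
     h 1 (\<mu> s) = 0 \<and> h 2 (\<mu> s) = 0 \<and> h 3 (\<mu> s) = 0 \<and>
     ((\<lambda>s. vector [h 4 (\<mu> s), h 5 (\<mu> s)] :: real^2) has_vector_derivative
        D (\<mu> s) *v vector [h 4 (\<mu> s), h 5 (\<mu> s)]) (at s within S) \<and>
     ((\<lambda>s. h 6 (\<mu> s)) has_real_derivative 0) (at s within S) \<and>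
     ((\<lambda>s. h 7 (\<mu> s)) has_real_derivative 0) (at s within S) \<and>
     ((\<lambda>s. h 8 (\<mu> s)) has_real_derivative 0) (at s within S) \<and>
     ((\<lambda>s. snd (\<mu> s)) has_vector_derivative
        - h 5 (\<mu> s) *\<^sub>R X1 (snd (\<mu> s)) + h 4 (\<mu> s) *\<^sub>R X2 (snd (\<mu> s))) (at s within S))"

text \<open>A change of parameter is a Lipschitzian surjection of closed intervals with almost everywhere
  nonzero derivative.  It need not be monotone: the maximum principle determines the control of an
  abnormal extremal only up to a measurable choice of sign, so an extremal may run along a
  solution of the reduced system in either direction and may turn back.\<close>

definition param_change :: "(real \<Rightarrow> real) \<Rightarrow> real \<Rightarrow> real \<Rightarrow> real \<Rightarrow> real \<Rightarrow> bool" where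
  "param_change \<phi> a b c d \<longleftrightarrow>
     (\<exists>L. L-lipschitz_on {a..b} \<phi>) \<and> \<phi> ` {a..b} = {c..d} \<and>
     (AE t in lebesgue_on {a..b}. \<exists>r. r \<noteq> 0 \<and> (\<phi> has_real_derivative r) (at t within {a..b}))"

definition reparameterized_reduced_curve :: "real \<Rightarrow> real \<Rightarrow> (real \<Rightarrow> cotangent) \<Rightarrow> bool" where
  "reparameterized_reduced_curve a b \<gamma> \<longleftrightarrow>
     (\<exists>\<mu> \<phi> c d. reduced_curve {c..d} \<mu> \<and> param_change \<phi> a b c d \<and> (\<forall>t\<in>{a..b}. \<gamma> t = \<mu> (\<phi> t)))"


section \<open>Extremals on which \<open>h 4\<close> and \<open>h 5\<close> vanish simultaneously\<close>

text \<open>The points with \<open>h 4 = h 5 = 0\<close> are equilibria of the reduced system, but not of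
  the abnormal extremals.  Hence an extremal that meets such a point is not a
  reparameterization of a single solution of the reduced system.  Two examples: an extremal contained
  in the set of these points, and an extremal that crosses it at an isolated time.\<close>

lemma has_vector_derivative_vector_2D:
  assumes "((\<lambda>s. vector [f s, g s] :: real^2) has_vector_derivative v) (at s within S)"
  shows "(f has_real_derivative v$1) (at s within S)" "(g has_real_derivative v$2) (at s within S)"
  using bounded_linear.has_vector_derivative[OF bounded_linear_vec_nth[of 1] assms]
    bounded_linear.has_vector_derivative[OF bounded_linear_vec_nth[of 2] assms]
  by (simp_all add: has_real_derivative_iff_has_vector_derivative)

lemma reduced_curve_equilibrium:
  assumes "reduced_curve {c..d} \<mu>" "s0 \<in> {c..d}" "h 4 (\<mu> s0) = 0" "h 5 (\<mu> s0) = 0" "s \<in> {c..d}"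
  shows "h 4 (\<mu> s) = 0 \<and> h 5 (\<mu> s) = 0 \<and> snd (\<mu> s) = snd (\<mu> s0)"
proof -
  define x where "x = (\<lambda>s. h 4 (\<mu> s))"
  define y where "y = (\<lambda>s. h 5 (\<mu> s))"
  define A where "A = h 7 (\<mu> s0)"
  define B where "B = h 6 (\<mu> s0)"
  define C where "C = h 8 (\<mu> s0)"
  note red = assms(1)[unfolded reduced_curve_def, rule_format]
  have const: "h i (\<mu> r) = h i (\<mu> s0)" if i: "i \<in> {6,7,8}" and r: "r \<in> {c..d}" for i r
  proof -
    have "\<exists>k. \<forall>s\<in>{c..d}. h i (\<mu> s) = k"
      by (rule has_field_derivative_zero_constant) (use i red in auto)
    then show ?thesis using r assms(2) by metis
  qed
  have dx: "(x has_real_derivative A * x r - B * y r) (at r within {c..d})"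
    and dy: "(y has_real_derivative C * x r - A * y r) (at r within {c..d})" if "r \<in> {c..d}" for r
  proof -
    have *: "((\<lambda>s. vector [x s, y s] :: real^2) has_vector_derivative
        D (\<mu> r) *v vector [x r, y r]) (at r within {c..d})"
      using red[OF that] unfolding x_def y_def by blast
    show "(x has_real_derivative A * x r - B * y r) (at r within {c..d})"
      "(y has_real_derivative C * x r - A * y r) (at r within {c..d})"
      using has_vector_derivative_vector_2D[OF *] const[of _ r] that
      by (simp_all add: D_def A_def B_def C_def matrix_vector_mult_def sum_2)
  qed
  define K where "K = 2 * \<bar>A\<bar> + \<bar>B\<bar> + \<bar>C\<bar>"
  define n where "n = (\<lambda>r. (x r)^2 + (y r)^2)"
  define n' where "n' = (\<lambda>r. 2 * x r * (A * x r - B * y r) + 2 * y r * (C * x r - A * y r))"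
  have dn: "(n has_real_derivative n' r) (at r within {c..d})" if "r \<in> {c..d}" for r
    unfolding n_def n'_def by (rule derivative_eq_intros dx[OF that] dy[OF that] refl | simp)+
  have bound: "\<bar>n' r\<bar> \<le> K * n r" for r
  proof -
    have xy: "2 * \<bar>x r\<bar> * \<bar>y r\<bar> \<le> n r"
      using sum_squares_bound[of "\<bar>x r\<bar>" "\<bar>y r\<bar>"] by (simp add: n_def)
    have "n' r = 2 * A * ((x r)^2 - (y r)^2) + (C - B) * (2 * x r * y r)"
      by (simp add: n'_def field_simps power2_eq_square)
    also have "\<bar>\<dots>\<bar> \<le> \<bar>2 * A * ((x r)^2 - (y r)^2)\<bar> + \<bar>(C - B) * (2 * x r * y r)\<bar>"
      by (rule abs_triangle_ineq)
    also have "\<dots> = 2 * \<bar>A\<bar> * \<bar>(x r)^2 - (y r)^2\<bar> + \<bar>C - B\<bar> * (2 * \<bar>x r\<bar> * \<bar>y r\<bar>)"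
      by (simp add: abs_mult)
    also have "\<dots> \<le> 2 * \<bar>A\<bar> * n r + (\<bar>B\<bar> + \<bar>C\<bar>) * n r"
      by (intro add_mono mult_mono xy) (auto simp: n_def abs_le_iff)
    finally show ?thesis by (simp add: K_def algebra_simps)
  qed
  have n0: "n s0 = 0" using assms(3,4) by (simp add: n_def x_def y_def)
  have npos: "n r \<ge> 0" for r by (simp add: n_def)
  have de: "((\<lambda>r. exp (k * r) * n r) has_derivative (\<lambda>v. v * (exp (k * r) * (k * n r + n' r))))
      (at r within {a..b})" if "{a..b} \<subseteq> {c..d}" "a \<le> r" "r \<le> b" for k r a b
  proof -
    have "r \<in> {c..d}" using that by auto
    from dn[OF this] have *: "(n has_real_derivative n' r) (at r within {a..b})"
      using that(1) by (rule DERIV_subset)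
    have "((\<lambda>r. exp (k * r) * n r) has_real_derivative exp (k * r) * (k * n r + n' r))
        (at r within {a..b})"
      by (rule derivative_eq_intros * refl | simp add: algebra_simps)+
    then show ?thesis
      unfolding has_field_derivative_def by (rule has_derivative_eq_rhs) (simp add: fun_eq_iff)
  qed
  have nz: "n r = 0" if r: "r \<in> {c..d}" for r
  proof (cases "s0 \<le> r")
    case True
    obtain z where "z \<in> {s0..r}"
      "exp (- K * r) * n r - exp (- K * s0) * n s0 = (r - s0) * (exp (- K * z) * (- K * n z + n' z))"
      using mvt_very_simple[OF True de[where k = "- K"]] r assms(2) by auto
    moreover have "- K * n z + n' z \<le> 0" using bound[of z] by auto
    ultimately have "exp (- K * r) * n r \<le> 0"
      using True n0 by (simp add: mult_nonneg_nonpos)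
    then show ?thesis using npos[of r] by (simp add: mult_le_0_iff)
  next
    case False
    then have le: "r \<le> s0" by simp
    obtain z where "z \<in> {r..s0}"
      "exp (K * s0) * n s0 - exp (K * r) * n r = (s0 - r) * (exp (K * z) * (K * n z + n' z))"
      using mvt_very_simple[OF le de[where k = "K"]] r assms(2) by auto
    moreover have "K * n z + n' z \<ge> 0" using bound[of z] by auto
    ultimately have "exp (K * r) * n r \<le> 0"
      using le n0 by (metis add_0 diff_ge_0_iff_ge exp_ge_zero mult_nonneg_nonneg mult_zero_right
        diff_0 neg_0_le_iff_le)
    then show ?thesis using npos[of r] by (simp add: mult_le_0_iff)
  qed
  have z: "h 4 (\<mu> r) = 0 \<and> h 5 (\<mu> r) = 0" if "r \<in> {c..d}" for r
    using nz[OF that] by (simp add: n_def x_def y_def)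
  have "\<exists>k. \<forall>s\<in>{c..d}. snd (\<mu> s) = k"
  proof (rule has_derivative_zero_constant)
    fix r assume r: "r \<in> {c..d}"
    have "((\<lambda>s. snd (\<mu> s)) has_vector_derivative 0) (at r within {c..d})"
      using red[OF r] z[OF r] by simp
    then show "((\<lambda>s. snd (\<mu> s)) has_derivative (\<lambda>h. 0)) (at r within {c..d})"
      by (simp add: has_vector_derivative_def)
  qed simp
  then show ?thesis using z assms(2,5) by metis
qed

lemma constant_velocity_control_const:
  "a \<noteq> 0 \<or> b \<noteq> 0 \<Longrightarrow> constant_velocity_control T (\<lambda>t. a) (\<lambda>t. b)"
  unfolding constant_velocity_control_def
  by (intro conjI exI[of _ "a^2 + b^2"]) (auto simp: sum_power2_eq_zero_iff)

lemma not_reparameterized: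
  assumes "reparameterized_reduced_curve a b \<gamma>" "t0 \<in> {a..b}" "h 4 (\<gamma> t0) = 0" "h 5 (\<gamma> t0) = 0"
    "t \<in> {a..b}"
  shows "snd (\<gamma> t) = snd (\<gamma> t0)"
proof -
  obtain \<mu> \<phi> c d where *: "reduced_curve {c..d} \<mu>" "param_change \<phi> a b c d" "\<forall>t\<in>{a..b}. \<gamma> t = \<mu> (\<phi> t)"
    using assms(1) unfolding reparameterized_reduced_curve_def by blast
  then have "\<phi> t0 \<in> {c..d}" "\<phi> t \<in> {c..d}" using assms(2,5) by (auto simp: param_change_def)
  then show ?thesis using reduced_curve_equilibrium[OF *(1), of "\<phi> t0" "\<phi> t"] *(3) assms by auto
qed

lemma equilibrium_extremal:
  defines "\<gamma> \<equiv> \<lambda>t. (axis 6 1, t *\<^sub>R axis 2 1) :: cotangent"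
  shows "abnormal_extremal 1 \<gamma> \<and> (\<forall>t. h 4 (\<gamma> t) = 0 \<and> h 5 (\<gamma> t) = 0) \<and>
    \<not> reparameterized_reduced_curve 0 1 \<gamma>"
proof (intro conjI)
  have der: "(\<gamma> has_vector_derivative hamiltonian_field 0 1 (\<gamma> t)) (at t within S)" for t S
  proof -
    have "hamiltonian_field 0 1 (\<gamma> t) = (0, axis 2 1)"
      by (simp add: hamiltonian_field_def \<gamma>_def h_def X_defs vec_eq_8 axis_def)
    then show ?thesis unfolding \<gamma>_def
      by (auto intro!: derivative_eq_intros has_vector_derivative_Pair)
  qed
  have "1-lipschitz_on {0..1} \<gamma>"
    by (rule lipschitz_onI) (auto simp: \<gamma>_def dist_Pair_Pair dist_norm norm_axis_1 simp flip: scaleR_diff_left)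
  moreover have "constant_velocity_control 1 (\<lambda>t. 0) (\<lambda>t. 1)"
    by (rule constant_velocity_control_const) simp
  ultimately show "abnormal_extremal 1 \<gamma>"
    unfolding abnormal_extremal_def using der
    by (intro conjI exI[of _ "\<lambda>t. 0::real"] exI[of _ "\<lambda>t. 1::real"] exI[of _ "1::real"])
      (auto simp: \<gamma>_def h_def axis_def vec_eq_8)
  show z: "\<forall>t. h 4 (\<gamma> t) = 0 \<and> h 5 (\<gamma> t) = 0" by (simp add: \<gamma>_def h_def axis_def)
  show "\<not> reparameterized_reduced_curve 0 1 \<gamma>"
  proof
    assume "reparameterized_reduced_curve 0 1 \<gamma>"
    then have "snd (\<gamma> 1) = snd (\<gamma> 0)" using z by (intro not_reparameterized) auto
    then show False by (simp add: \<gamma>_def vec_eq_8 axis_def)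
  qed
qed

lemma crossing_extremal:
  defines "\<gamma> \<equiv> \<lambda>t. ((1 - t) *\<^sub>R axis 5 1 + axis 7 1, - t *\<^sub>R axis 1 1) :: cotangent"
  shows "abnormal_extremal 2 \<gamma> \<and> (\<forall>t. h 4 (\<gamma> t) = 0 \<and> h 5 (\<gamma> t) = 0 \<longleftrightarrow> t = 1) \<and>
    \<not> reparameterized_reduced_curve 0 2 \<gamma>"
proof (intro conjI)
  have der: "(\<gamma> has_vector_derivative hamiltonian_field (-1) 0 (\<gamma> t)) (at t within S)" for t S
  proof -
    have "hamiltonian_field (-1) 0 (\<gamma> t) = (- axis 5 1, - axis 1 1)"
      by (simp add: hamiltonian_field_def \<gamma>_def h_def X_defs vec_eq_8 axis_def)
    then show ?thesis unfolding \<gamma>_def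
      by (auto intro!: derivative_eq_intros has_vector_derivative_Pair)
  qed
  have "2-lipschitz_on {0..2} \<gamma>"
  proof (rule lipschitz_onI)
    fix s t :: real
    have "\<gamma> s - \<gamma> t = (t - s) *\<^sub>R (axis 5 1, axis 1 1)"
      by (simp add: \<gamma>_def algebra_simps)
    then have "dist (\<gamma> s) (\<gamma> t) = \<bar>t - s\<bar> * norm (axis 5 1 :: real^8, axis 1 1 :: real^8)"
      by (simp only: dist_norm norm_scaleR)
    also have "\<dots> \<le> \<bar>t - s\<bar> * 2"
      using norm_Pair_le[of "axis 5 1 :: real^8" "axis 1 1 :: real^8"]
      by (intro mult_left_mono) (auto simp: norm_axis_1)
    finally show "dist (\<gamma> s) (\<gamma> t) \<le> 2 * dist s t" by (simp add: dist_real_def abs_minus_commute)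
  qed simp
  moreover have "constant_velocity_control 2 (\<lambda>t. -1) (\<lambda>t. 0)"
    by (rule constant_velocity_control_const) simp
  ultimately show "abnormal_extremal 2 \<gamma>"
    unfolding abnormal_extremal_def using der
    by (intro conjI exI[of _ "\<lambda>t. -1::real"] exI[of _ "\<lambda>t. 0::real"] exI[of _ "2::real"])
      (auto simp: \<gamma>_def h_def axis_def vec_eq_8)
  show z: "\<forall>t. h 4 (\<gamma> t) = 0 \<and> h 5 (\<gamma> t) = 0 \<longleftrightarrow> t = 1" by (simp add: \<gamma>_def h_def axis_def)
  show "\<not> reparameterized_reduced_curve 0 2 \<gamma>"
  proof
    assume "reparameterized_reduced_curve 0 2 \<gamma>"
    then have "snd (\<gamma> 0) = snd (\<gamma> 1)" using z by (intro not_reparameterized) auto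
    then show False by (simp add: \<gamma>_def vec_eq_8 axis_def)
  qed
qed

end

theory Submission
  imports Defs
begin

text \<open>
  The maximized function is linear in the control, so maximality forces \<open>h 1 = h 2 = 0\<close>; since the
  control never vanishes, the equations for \<open>h 1\<close> and \<open>h 2\<close> give \<open>h 3 = 0\<close>, and the equation for
  \<open>h 3\<close> then says that \<open>u\<close> is orthogonal to \<open>(h 4, h 5)\<close> almost everywhere.  Where
  \<open>(h 4, h 5) \<noteq> 0\<close> this means \<open>u = r (- h 5, h 4)\<close> with a measurable factor \<open>r \<noteq> 0\<close>, so the velocity
  of the extremal is \<open>r\<close> times the velocity field of the reduced system, and the change of parameter
  must be a primitive \<open>\<phi>\<close> of \<open>r\<close>.

  Two difficulties remain.  A primitive of a measurable function has it as its derivative only almost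
  everywhere, by Lebesgue's differentiation theorem.  Here \<open>r\<close> has the special form
  \<open>g\<^sub>1 q\<^sub>1' + g\<^sub>2 q\<^sub>2'\<close> with Lipschitz functions \<open>g\<^sub>i\<close>, \<open>q\<^sub>i\<close>, and for such products an elementary
  quadratic estimate suffices (\<open>lipschitz_stieltjes_primitive\<close>).  Then \<open>\<gamma> = \<mu> \<circ> \<phi>\<close> has to be shown
  for a solution \<open>\<mu>\<close> of the reduced system, although \<open>\<phi>\<close> need not be injective.  The linear
  system for \<open>(h 4, h 5)\<close> has a constant trace-free matrix, whose square is scalar, so its flow is
  explicit; the remaining coordinates of \<open>\<mu>\<close> are iterated primitives.  The pull-back of
  \<open>(h 4, h 5)\<close> by this flow and the difference between \<open>q\<close> and the base curve of \<open>\<mu> \<circ> \<phi>\<close> are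
  Lipschitz with almost everywhere zero derivative, hence constant, which identifies the two curves
  (\<open>reparameterization_of_scaled_flow\<close>).

  Suppose now that \<open>Z = {h 4 = h 5 = 0}\<close> has positive measure.  At an accumulation point of \<open>Z\<close> in
  \<open>Z\<close> where the equations hold, \<open>h 4\<close> and \<open>h 5\<close> have zero derivative, so the symmetric matrix
  \<open>M = ((h 6, h 7), (h 7, h 8))\<close> kills a nonzero vector and \<open>M\<^sup>2 = tr M \<cdot> M\<close>.  Together with
  \<open>(h 4, h 5) = M (q - q\<^sub>0)\<close> and \<open>(h 4, h 5) \<bottom> u\<close> this makes \<open>(h 4)\<^sup>2 + (h 5)\<^sup>2\<close> constant, hence zero
  throughout.  The control then stays in the line \<open>ker M\<close>, and replacing \<open>(h 4, h 5)\<close> by a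
  constant vector orthogonal to that line gives a curve over the same trajectory that satisfies the same
  equations and to which the first part applies (\<open>degenerate_singular_curve\<close>).

  Conversely, a solution of the reduced system is an integral curve of the Hamiltonian field with
  control \<open>(- h 5, h 4)\<close>, so the chain rule yields the Hamiltonian system along a reparameterization.
  Nontriviality holds because a covector vanishing at one time would force \<open>q\<close> to be constant.
\<close>

section \<open>Lipschitz functions with almost everywhere known derivative\<close>

lemma AE_lebesgue_on_iff_negligible:
  fixes S :: "'a::euclidean_space set"
  assumes "S \<in> sets lebesgue"
  shows "(AE t in lebesgue_on S. P t) \<longleftrightarrow> (\<exists>N. negligible N \<and> (\<forall>t\<in>S - N. P t))"
proof -
  have "(AE t in lebesgue_on S. P t) \<longleftrightarrow> (AE t in lebesgue. t \<in> S \<longrightarrow> P t)"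
    using assms by (simp add: AE_restrict_space_iff)
  also have "\<dots> \<longleftrightarrow> (\<exists>N. negligible N \<and> (\<forall>t\<in>S - N. P t))"
    unfolding eventually_ae_filter negligible_iff_null_sets
    by (auto simp: subset_eq)
  finally show ?thesis .
qed

text \<open>The fundamental theorem of calculus for Lipschitz functions.  The difference quotients
  \<open>\<Delta> n\<close> of \<open>f\<close> with step \<open>\<delta> n = 1 / (n + 1)\<close> are bounded by the Lipschitz constant and converge to
  \<open>v\<close> off a null set, so dominated convergence applies; on the other hand the integral of \<open>\<Delta> n\<close>
  telescopes to a difference of averages of \<open>f\<close> near \<open>b\<close> and near \<open>a\<close>.\<close>

lemma lipschitz_ae_derivative_integral:
  fixes f v g :: "real \<Rightarrow> real"
  assumes "a \<le> b" and lip: "L-lipschitz_on {a..b} f" and neg: "negligible N"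
    and der: "\<And>t. t \<in> {a..b} - N \<Longrightarrow> (f has_real_derivative v t) (at t within {a..b})"
  shows "continuous_on {a..b} g \<Longrightarrow> (\<lambda>t. g t * v t) integrable_on {a..b}"
    and "(v has_integral (f b - f a)) {a..b}"
proof -
  \<comment> \<open>\<open>f\<close> is extended by constants, so that the forward quotients make sense up to \<open>b\<close>.\<close>
  define F where "F x = f (max a (min b x))" for x
  define \<delta> where "\<delta> n = inverse (real (Suc n))" for n
  define \<Delta> where "\<Delta> n x = (F (x + \<delta> n) - F x) / \<delta> n" for n x
  have h: "\<delta> n > 0" "\<delta> n \<le> 1" for n by (auto simp: \<delta>_def field_simps)
  have h0: "\<delta> \<longlonglongrightarrow> 0" unfolding \<delta>_def by (rule LIMSEQ_inverse_real_of_nat)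
  have L: "L \<ge> 0" using lip by (simp add: lipschitz_on_def)
  have Flip: "\<bar>F x - F y\<bar> \<le> L * \<bar>x - y\<bar>" for x y
  proof -
    have "\<bar>F x - F y\<bar> \<le> L * \<bar>max a (min b x) - max a (min b y)\<bar>"
      using lipschitz_onD[OF lip, of "max a (min b x)" "max a (min b y)"] \<open>a \<le> b\<close>
      by (simp add: F_def dist_real_def)
    also have "\<dots> \<le> L * \<bar>x - y\<bar>" by (rule mult_left_mono[OF _ L]) auto
    finally show ?thesis .
  qed
  have "L-lipschitz_on UNIV F"
    by (rule lipschitz_onI) (use Flip L in \<open>auto simp: dist_real_def\<close>)
  then have Fcont: "continuous_on S F" for S
    using lipschitz_on_continuous_on continuous_on_subset by blast
  have \<Delta>cont: "continuous_on S (\<Delta> n)" for S n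
    unfolding \<Delta>_def using h(1)[of n]
    by (intro continuous_intros continuous_on_compose2[OF Fcont[of UNIV]] Fcont) auto
  have \<Delta>bound: "\<bar>\<Delta> n x\<bar> \<le> L" for n x
    using Flip[of "x + \<delta> n" x] h(1)[of n] by (simp add: \<Delta>_def field_simps)
  have Fder: "(\<lambda>n. \<Delta> n x) \<longlonglongrightarrow> v x" if x: "x \<in> {a..b} - (insert b N)" for x
  proof -
    have D: "((\<lambda>y. (f y - f x) / (y - x)) \<longlongrightarrow> v x) (at x within {a..b})"
      using der[of x] x by (simp add: has_field_derivative_iff)
    have ev: "\<forall>\<^sub>F n in sequentially. x + \<delta> n \<in> {a..b}"
      using order_tendstoD(2)[OF h0, of "b - x"] x
      by (auto elim!: eventually_mono simp: less_imp_le h)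
        (smt (verit) h(1))
    have "filterlim (\<lambda>n. x + \<delta> n) (at x within {a..b}) sequentially"
      unfolding filterlim_at
    proof
      show "\<forall>\<^sub>F n in sequentially. x + \<delta> n \<in> {a..b} \<and> x + \<delta> n \<noteq> x"
        using ev by eventually_elim (use h(1) in \<open>auto simp: less_le\<close>)
      show "(\<lambda>n. x + \<delta> n) \<longlonglongrightarrow> x" using tendsto_add[OF tendsto_const h0, of x] by simp
    qed
    from filterlim_compose[OF D this]
    have "(\<lambda>n. (f (x + \<delta> n) - f x) / (x + \<delta> n - x)) \<longlonglongrightarrow> v x" .
    moreover have "\<forall>\<^sub>F n in sequentially. (f (x + \<delta> n) - f x) / (x + \<delta> n - x) = \<Delta> n x"
      using ev by eventually_elim (use x in \<open>auto simp: \<Delta>_def F_def max_def min_def\<close>)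
    ultimately show ?thesis using tendsto_cong by fast
  qed
  have neg': "negligible (insert b N)" using neg by simp
  have DC: "(\<lambda>t. g t * v t) integrable_on {a..b}"
      "(\<lambda>n. integral {a..b} (\<lambda>t. g t * \<Delta> n t)) \<longlonglongrightarrow> integral {a..b} (\<lambda>t. g t * v t)"
    if g: "continuous_on {a..b} g" for g
  proof -
    define k where "k n t = (if t \<in> insert b N then 0 else g t * \<Delta> n t)" for n t
    define w where "w t = (if t \<in> insert b N then 0 else g t * v t)" for t
    obtain B where B: "\<And>t. t \<in> {a..b} \<Longrightarrow> \<bar>g t\<bar> \<le> B"
      using compact_imp_bounded[OF compact_continuous_image[OF g compact_Icc]]
      by (force simp: bounded_iff)
    have int: "(\<lambda>t. g t * \<Delta> n t) integrable_on {a..b}" for n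
      by (intro integrable_continuous_real continuous_intros g \<Delta>cont)
    have kint: "k n integrable_on {a..b}" for n
      by (rule integrable_spike[OF int[of n] neg']) (auto simp: k_def)
    have "B \<ge> 0" using B[of a] \<open>a \<le> b\<close> by auto
    have 1: "norm (k n t) \<le> B * L" if "t \<in> {a..b}" for n t
      using B[OF that] \<Delta>bound[of n t] L \<open>B \<ge> 0\<close>
      by (auto simp: k_def abs_mult intro!: mult_mono)
    have 2: "(\<lambda>n. k n t) \<longlonglongrightarrow> w t" if "t \<in> {a..b}" for t
      using that by (auto simp: k_def w_def intro!: tendsto_intros Fder)
    have *: "w integrable_on {a..b}" "(\<lambda>n. integral {a..b} (k n)) \<longlonglongrightarrow> integral {a..b} w"
      using dominated_convergence[of k "{a..b}" "\<lambda>t. B * L" w] kint 1 2 by auto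
    show "(\<lambda>t. g t * v t) integrable_on {a..b}"
      by (rule integrable_spike[OF *(1) neg']) (auto simp: w_def)
    have "integral {a..b} (k n) = integral {a..b} (\<lambda>t. g t * \<Delta> n t)" for n
      by (rule integral_spike[OF neg']) (auto simp: k_def)
    moreover have "integral {a..b} w = integral {a..b} (\<lambda>t. g t * v t)"
      by (rule integral_spike[OF neg']) (auto simp: w_def)
    ultimately show "(\<lambda>n. integral {a..b} (\<lambda>t. g t * \<Delta> n t)) \<longlonglongrightarrow> integral {a..b} (\<lambda>t. g t * v t)"
      using *(2) by simp
  qed
  then show "continuous_on {a..b} g \<Longrightarrow> (\<lambda>t. g t * v t) integrable_on {a..b}" by blast
  \<comment> \<open>All steps are at most 1, so the quotients only see \<open>F\<close> on \<open>{a..b+1}\<close>.\<close>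
  obtain P where P: "\<And>x. x \<in> {a..b+1} \<Longrightarrow> (P has_vector_derivative F x) (at x within {a..b+1})"
    using antiderivative_continuous[OF Fcont] by blast
  have Plim: "(\<lambda>n. (P (x + \<delta> n) - P x) / \<delta> n) \<longlonglongrightarrow> F x" if x: "x \<in> {a..b}" for x
  proof -
    have D: "((\<lambda>y. (P y - P x) / (y - x)) \<longlongrightarrow> F x) (at x within {a..b+1})"
      using P[of x] x
      by (simp add: has_field_derivative_iff flip: has_real_derivative_iff_has_vector_derivative)
    have "filterlim (\<lambda>n. x + \<delta> n) (at x within {a..b+1}) sequentially"
      unfolding filterlim_at
    proof
      show "\<forall>\<^sub>F n in sequentially. x + \<delta> n \<in> {a..b+1} \<and> x + \<delta> n \<noteq> x"
        using h x by (intro always_eventually) (smt (verit) atLeastAtMost_iff)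
      show "(\<lambda>n. x + \<delta> n) \<longlonglongrightarrow> x" using tendsto_add[OF tendsto_const h0, of x] by simp
    qed
    from filterlim_compose[OF D this] show ?thesis by simp
  qed
  have "integral {a..b} (\<Delta> n) = (P (b + \<delta> n) - P b) / \<delta> n - (P (a + \<delta> n) - P a) / \<delta> n" for n
  proof -
    have "((\<lambda>x. (P (x + \<delta> n) - P x) / \<delta> n) has_vector_derivative \<Delta> n x) (at x within {a..b})"
      if x: "x \<in> {a..b}" for x
    proof -
      have "((\<lambda>x. x + \<delta> n) has_real_derivative 1) (at x within {a..b})"
        by (auto intro!: derivative_eq_intros)
      moreover have "(P has_real_derivative F (x + \<delta> n)) (at (x + \<delta> n) within (\<lambda>x. x + \<delta> n) ` {a..b})"
        unfolding has_real_derivative_iff_has_vector_derivative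
        by (rule has_vector_derivative_within_subset[OF P]) (use h[of n] x in auto)
      ultimately have 1: "((\<lambda>x. P (x + \<delta> n)) has_real_derivative F (x + \<delta> n)) (at x within {a..b})"
        using DERIV_image_chain[of P _ "\<lambda>x. x + \<delta> n" x "{a..b}" 1] by (simp add: o_def)
      have 2: "(P has_real_derivative F x) (at x within {a..b})"
        unfolding has_real_derivative_iff_has_vector_derivative
        by (rule has_vector_derivative_within_subset[OF P]) (use x in auto)
      show ?thesis unfolding has_real_derivative_iff_has_vector_derivative[symmetric] \<Delta>_def
        using h(1)[of n] by (auto intro!: derivative_eq_intros 1 2)
    qed
    from fundamental_theorem_of_calculus[OF \<open>a \<le> b\<close> this]
    show ?thesis by (simp add: integral_unique diff_divide_distrib)
  qed
  moreover have "(\<lambda>n. (P (b + \<delta> n) - P b) / \<delta> n - (P (a + \<delta> n) - P a) / \<delta> n) \<longlonglongrightarrow> F b - F a"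
    by (intro tendsto_diff Plim) (use \<open>a \<le> b\<close> in auto)
  ultimately have "(\<lambda>n. integral {a..b} (\<Delta> n)) \<longlonglongrightarrow> f b - f a" using \<open>a \<le> b\<close> by (simp add: F_def)
  moreover have "(\<lambda>n. integral {a..b} (\<Delta> n)) \<longlonglongrightarrow> integral {a..b} v"
    using DC(2)[of "\<lambda>t. 1"] by simp
  ultimately have "integral {a..b} v = f b - f a" by (rule LIMSEQ_unique[symmetric])
  moreover have "v integrable_on {a..b}" using DC(1)[of "\<lambda>t. 1"] by simp
  ultimately show "(v has_integral (f b - f a)) {a..b}" using integrable_integral by metis
qed

lemma lipschitz_ae_derivative_zero_constant:
  fixes f :: "real \<Rightarrow> real"
  assumes lip: "L-lipschitz_on {a..b} f" and neg: "negligible N"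
    and der: "\<And>t. t \<in> {a..b} - N \<Longrightarrow> (f has_real_derivative 0) (at t within {a..b})"
    and "s \<in> {a..b}" "t \<in> {a..b}"
  shows "f s = f t"
proof -
  have "f t = f a" if t: "t \<in> {a..b}" for t
  proof -
    have "((\<lambda>x. 0) has_integral (f t - f a)) {a..t}"
      by (rule lipschitz_ae_derivative_integral(2)[OF _ lipschitz_on_subset[OF lip] neg
            DERIV_subset[OF der]]) (use t in auto)
    then show ?thesis using has_integral_0_eq by fastforce
  qed
  then show ?thesis using assms by metis
qed

lemma lipschitz_derivative_bound:
  fixes f :: "real \<Rightarrow> real"
  assumes "L-lipschitz_on {a..b} f" "a < b" "t \<in> {a..b}"
    and "(f has_real_derivative v) (at t within {a..b})"
  shows "\<bar>v\<bar> \<le> L"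
proof (rule tendsto_upperbound)
  show "((\<lambda>y. \<bar>(f y - f t) / (y - t)\<bar>) \<longlongrightarrow> \<bar>v\<bar>) (at t within {a..b})"
    using assms(4) unfolding has_field_derivative_iff by (rule tendsto_rabs)
  show "\<forall>\<^sub>F y in at t within {a..b}. \<bar>(f y - f t) / (y - t)\<bar> \<le> L"
    unfolding eventually_at_filter
    using lipschitz_onD[OF assms(1) _ assms(3)]
    by (intro always_eventually) (auto simp: dist_real_def abs_divide field_simps)
  show "at t within {a..b} \<noteq> bot"
    using assms(2,3) by (simp add: trivial_limit_within islimpt_Icc)
qed

text \<open>The product \<open>g f'\<close> has a Lipschitz primitive \<open>\<phi>\<close> that is differentiable with the expected
  derivative at every point outside the given null set: freezing \<open>g\<close> at \<open>s\<close> changes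
  \<open>\<phi> t - \<phi> s\<close> into \<open>g s (f t - f s)\<close> up to an error that is quadratic in \<open>t - s\<close>.\<close>

lemma lipschitz_stieltjes_primitive:
  fixes f g v :: "real \<Rightarrow> real"
  assumes "a < b" and lf: "Lf-lipschitz_on {a..b} f" and lg: "Lg-lipschitz_on {a..b} g"
    and neg: "negligible N"
    and der: "\<And>t. t \<in> {a..b} - N \<Longrightarrow> (f has_real_derivative v t) (at t within {a..b})"
  obtains \<phi> K where "K-lipschitz_on {a..b} \<phi>"
    "\<And>t. t \<in> {a..b} - N \<Longrightarrow> (\<phi> has_real_derivative g t * v t) (at t within {a..b})"
proof -
  \<comment> \<open>Setting the density to zero on \<open>N\<close> makes it bounded by \<open>Lf\<close> everywhere.\<close>
  define w where "w t = (if t \<in> N then 0 else v t)" for t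
  have wder: "(f has_real_derivative w t) (at t within {a..b})" if "t \<in> {a..b} - N" for t
    using der[OF that] that by (simp add: w_def)
  have L: "Lf \<ge> 0" "Lg \<ge> 0" using lf lg by (auto simp: lipschitz_on_def)
  have w: "\<bar>w t\<bar> \<le> Lf" if "t \<in> {a..b}" for t
    using lipschitz_derivative_bound[OF lf \<open>a < b\<close> that wder] that L by (cases "t \<in> N") (auto simp: w_def)
  have gcont: "continuous_on {a..b} g" using lg lipschitz_on_continuous_on by blast
  obtain B where B: "\<And>t. t \<in> {a..b} \<Longrightarrow> \<bar>g t\<bar> \<le> B"
    using compact_imp_bounded[OF compact_continuous_image[OF gcont compact_Icc]]
    by (force simp: bounded_iff)
  have B0: "B \<ge> 0" using B[of a] \<open>a < b\<close> by auto
  have flip: "\<bar>f x - f y\<bar> \<le> Lf * \<bar>x - y\<bar>" and glip: "\<bar>g x - g y\<bar> \<le> Lg * \<bar>x - y\<bar>"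
    if "x \<in> {a..b}" "y \<in> {a..b}" for x y
    using lipschitz_onD[OF lf that] lipschitz_onD[OF lg that] by (auto simp: dist_real_def)
  have int: "(\<lambda>t. g t * w t) integrable_on {a..b}"
    by (rule lipschitz_ae_derivative_integral(1)[OF _ lf neg wder gcont]) (use \<open>a < b\<close> in auto)
  define \<phi> where "\<phi> t = integral {a..t} (\<lambda>t. g t * w t)" for t
  have inc: "((\<lambda>t. g t * w t) has_integral (\<phi> t - \<phi> s)) {s..t}" "(w has_integral (f t - f s)) {s..t}"
    if "a \<le> s" "s \<le> t" "t \<le> b" for s t
  proof -
    have "(\<lambda>t. g t * w t) integrable_on {a..t}" "(\<lambda>t. g t * w t) integrable_on {s..t}"
      using that by (auto intro: integrable_subinterval_real[OF int])
    moreover from Henstock_Kurzweil_Integration.integral_combine[OF _ _ this(1), of s]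
    have "integral {s..t} (\<lambda>t. g t * w t) = \<phi> t - \<phi> s" using that by (simp add: \<phi>_def)
    ultimately show "((\<lambda>t. g t * w t) has_integral (\<phi> t - \<phi> s)) {s..t}"
      using integrable_integral by metis
    show "(w has_integral (f t - f s)) {s..t}"
      by (rule lipschitz_ae_derivative_integral(2)[OF _ lipschitz_on_subset[OF lf] neg
            DERIV_subset[OF wder]]) (use that in auto)
  qed
  have up: "\<bar>\<phi> t - \<phi> s - g s * (f t - f s)\<bar> \<le> Lg * Lf * (t - s)^2" "\<bar>\<phi> t - \<phi> s\<bar> \<le> B * Lf * (t - s)"
    if st: "a \<le> s" "s \<le> t" "t \<le> b" for s t
  proof -
    have "((\<lambda>x. g x * w x - g s * w x) has_integral (\<phi> t - \<phi> s - g s * (f t - f s))) {s..t}"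
      by (intro has_integral_diff has_integral_mult_right inc st)
    moreover have "norm (g x * w x - g s * w x) \<le> Lg * (t - s) * Lf" if x: "x \<in> {s..t}" for x
    proof -
      have "norm (g x * w x - g s * w x) = \<bar>g x - g s\<bar> * \<bar>w x\<bar>"
        by (simp add: abs_mult flip: left_diff_distrib)
      also have "\<dots> \<le> (Lg * (t - s)) * Lf"
      proof (rule mult_mono)
        show "\<bar>g x - g s\<bar> \<le> Lg * (t - s)"
          using glip[of x s] x st mult_left_mono[of "x - s" "t - s" Lg] L by auto
      qed (use w x st L in auto)
      finally show ?thesis .
    qed
    ultimately have "norm (\<phi> t - \<phi> s - g s * (f t - f s)) \<le> Lg * (t - s) * Lf * measure lborel {s..t}"
      by (intro has_integral_bound_real[of _ "{}"]) (use st L in auto)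
    then show "\<bar>\<phi> t - \<phi> s - g s * (f t - f s)\<bar> \<le> Lg * Lf * (t - s)^2"
      using st by (simp add: power2_eq_square mult_ac)
    have "norm (\<phi> t - \<phi> s) \<le> B * Lf * measure lborel {s..t}"
      by (intro has_integral_bound_real[of _ "{}", OF _ _ inc(1)])
        (use st L B0 B w in \<open>auto simp: abs_mult intro!: mult_mono\<close>)
    then show "\<bar>\<phi> t - \<phi> s\<bar> \<le> B * Lf * (t - s)" using st by simp
  qed
  have quad: "\<bar>\<phi> t - \<phi> s - g s * (f t - f s)\<bar> \<le> 2 * Lg * Lf * (t - s)^2"
    if st: "s \<in> {a..b}" "t \<in> {a..b}" for s t
  proof (cases "s \<le> t")
    case True
    then have "\<bar>\<phi> t - \<phi> s - g s * (f t - f s)\<bar> \<le> Lg * Lf * (t - s)^2" using up st by auto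
    moreover have "0 \<le> Lg * Lf * (t - s)^2" using L by simp
    ultimately show ?thesis by linarith
  next
    case False
    have "\<bar>(g s - g t) * (f s - f t)\<bar> \<le> (Lg * \<bar>s - t\<bar>) * (Lf * \<bar>s - t\<bar>)"
      unfolding abs_mult by (rule mult_mono) (use flip glip st L in auto)
    also have "\<dots> = Lg * Lf * (t - s)^2" 
      using abs_mult_self_eq[of "s - t"] by (simp add: power2_eq_square algebra_simps)
    finally have "\<bar>(g s - g t) * (f s - f t)\<bar> \<le> Lg * Lf * (t - s)^2" .
    moreover have "\<bar>\<phi> s - \<phi> t - g t * (f s - f t)\<bar> \<le> Lg * Lf * (t - s)^2"
      using up(1)[of t s] st False by (simp add: power2_commute)
    moreover have "\<phi> t - \<phi> s - g s * (f t - f s) =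
        (g s - g t) * (f s - f t) - (\<phi> s - \<phi> t - g t * (f s - f t))" by algebra
    ultimately show ?thesis by linarith
  qed
  show ?thesis
  proof
    show "(B * Lf)-lipschitz_on {a..b} \<phi>"
      by (rule lipschitz_on_leI) (use up(2) B0 L in \<open>auto simp: dist_real_def abs_minus_commute\<close>)
    fix s assume s: "s \<in> {a..b} - N"
    have "((\<lambda>t. (\<phi> t - \<phi> s) / (t - s) - g s * ((f t - f s) / (t - s))) \<longlongrightarrow> 0) (at s within {a..b})"
    proof (rule Lim_null_comparison)
      have "\<bar>(\<phi> t - \<phi> s) / (t - s) - g s * ((f t - f s) / (t - s))\<bar> \<le> 2 * Lg * Lf * \<bar>t - s\<bar>"
        if "t \<in> {a..b}" "t \<noteq> s" for t
      proof -
        have "(\<phi> t - \<phi> s) / (t - s) - g s * ((f t - f s) / (t - s))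
            = (\<phi> t - \<phi> s - g s * (f t - f s)) / (t - s)"
          by (simp only: diff_divide_distrib[of _ "g s * (f t - f s)"] times_divide_eq_right)
        moreover have "\<bar>\<phi> t - \<phi> s - g s * (f t - f s)\<bar> \<le> 2 * Lg * Lf * \<bar>t - s\<bar> * \<bar>t - s\<bar>"
          using quad[of s t] s that by (simp add: power2_eq_square mult.assoc)
        ultimately show ?thesis using that by (simp add: abs_divide pos_divide_le_eq)
      qed
      then show "\<forall>\<^sub>F t in at s within {a..b}.
          norm ((\<phi> t - \<phi> s) / (t - s) - g s * ((f t - f s) / (t - s))) \<le> 2 * Lg * Lf * \<bar>t - s\<bar>"
        unfolding eventually_at_filter by (intro always_eventually) auto
      show "((\<lambda>t. 2 * Lg * Lf * \<bar>t - s\<bar>) \<longlongrightarrow> 0) (at s within {a..b})"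
        by (auto intro!: tendsto_eq_intros)
    qed
    moreover have "((\<lambda>t. g s * ((f t - f s) / (t - s))) \<longlongrightarrow> g s * v s) (at s within {a..b})"
      using der[OF s] by (intro tendsto_intros) (simp add: has_field_derivative_iff)
    ultimately show "(\<phi> has_real_derivative g s * v s) (at s within {a..b})"
      unfolding has_field_derivative_iff using tendsto_add by fastforce
  qed
qed

lemma derivative_zero_at_limit_of_zeros:
  fixes f :: "real \<Rightarrow> real"
  assumes "(f has_real_derivative v) (at t within S)" "Z \<subseteq> S" "t \<in> Z" "t islimpt Z"
    and zero: "\<And>x. x \<in> Z \<Longrightarrow> f x = 0"
  shows "v = 0"
proof (rule tendsto_unique)
  show "at t within Z \<noteq> bot" using assms(4) by (simp add: trivial_limit_within)
  show "((\<lambda>x. (f x - f t) / (x - t)) \<longlongrightarrow> v) (at t within Z)"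
    using DERIV_subset[OF assms(1,2)] by (simp add: has_field_derivative_iff)
  show "((\<lambda>x. (f x - f t) / (x - t)) \<longlongrightarrow> 0) (at t within Z)"
    by (rule tendsto_eventually) (use zero assms(3) in \<open>auto simp: eventually_at_filter\<close>)
qed

text \<open>Each isolated point is the only point of \<open>Z\<close> in some member of a countable basis.\<close>

lemma countable_isolated_points:
  fixes Z :: "'a::second_countable_topology set"
  shows "countable {x \<in> Z. \<not> x islimpt Z}"
proof -
  obtain B :: "'a set set" where B: "countable B" "topological_basis B"
    using ex_countable_basis by blast
  have "{x \<in> Z. \<not> x islimpt Z} \<subseteq> (\<lambda>U. the_elem (Z \<inter> U)) ` B"
  proof
    fix x assume "x \<in> {x \<in> Z. \<not> x islimpt Z}"
    then obtain W where W: "x \<in> Z" "open W" "x \<in> W" "\<And>y. y \<in> Z \<Longrightarrow> y \<in> W \<Longrightarrow> y = x"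
      unfolding islimpt_def by blast
    obtain U where "U \<in> B" "x \<in> U" "U \<subseteq> W" using topological_basisE[OF B(2) W(2,3)] .
    then have "Z \<inter> U = {x}" using W by blast
    then have "x = the_elem (Z \<inter> U)" by simp
    then show "x \<in> (\<lambda>U. the_elem (Z \<inter> U)) ` B" using \<open>U \<in> B\<close> by (rule image_eqI)
  qed
  then show ?thesis using B(1) countable_image countable_subset by blast
qed

lemma lipschitz_ae_derivative_zero_constant_vector:
  fixes f :: "real \<Rightarrow> 'a::euclidean_space"
  assumes lip: "L-lipschitz_on {a..b} f" and neg: "negligible N"
    and der: "\<And>t. t \<in> {a..b} - N \<Longrightarrow> (f has_vector_derivative 0) (at t within {a..b})"
    and st: "s \<in> {a..b}" "t \<in> {a..b}"
  shows "f s = f t"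
proof (rule euclidean_eqI)
  fix i :: 'a assume i: "i \<in> Basis"
  have "\<bar>f x \<bullet> i - f y \<bullet> i\<bar> \<le> dist (f x) (f y)" for x y
    using Basis_le_norm[OF i, of "f x - f y"] by (simp add: dist_norm inner_diff_left)
  then have "L-lipschitz_on {a..b} (\<lambda>x. f x \<bullet> i)"
    using lip unfolding lipschitz_on_def dist_real_def by (meson order_trans)
  moreover have "((\<lambda>x. f x \<bullet> i) has_real_derivative 0) (at t within {a..b})" if "t \<in> {a..b} - N" for t
    using bounded_linear.has_vector_derivative[OF bounded_linear_inner_left der[OF that], of i]
    by (simp add: has_real_derivative_iff_has_vector_derivative)
  ultimately show "f s \<bullet> i = f t \<bullet> i"
    using lipschitz_ae_derivative_zero_constant[OF _ neg _ st] by blast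
qed

lemma lipschitz_on_mult_Icc:
  fixes f g :: "real \<Rightarrow> real"
  assumes f: "L-lipschitz_on {a..b} f" and g: "M-lipschitz_on {a..b} g"
  shows "\<exists>K. K-lipschitz_on {a..b} (\<lambda>t. f t * g t)"
proof -
  have "bounded (f ` {a..b})" "bounded (g ` {a..b})"
    by (auto intro!: compact_imp_bounded compact_continuous_image lipschitz_on_continuous_on f g)
  then obtain B C where B: "\<And>t. t \<in> {a..b} \<Longrightarrow> \<bar>f t\<bar> \<le> B" and C: "\<And>t. t \<in> {a..b} \<Longrightarrow> \<bar>g t\<bar> \<le> C"
    by (fastforce simp: bounded_iff)
  have LM: "L \<ge> 0" "M \<ge> 0" using f g by (auto simp: lipschitz_on_def)
  have "(\<bar>B\<bar> * M + \<bar>C\<bar> * L)-lipschitz_on {a..b} (\<lambda>t. f t * g t)"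
  proof (rule lipschitz_onI)
    fix x y assume xy: "x \<in> {a..b}" "y \<in> {a..b}"
    have "f x * g x - f y * g y = f x * (g x - g y) + g y * (f x - f y)" by algebra
    then have "dist (f x * g x) (f y * g y) \<le> \<bar>f x\<bar> * \<bar>g x - g y\<bar> + \<bar>g y\<bar> * \<bar>f x - f y\<bar>"
      by (metis abs_mult abs_triangle_ineq dist_real_def)
    also have "\<dots> \<le> \<bar>B\<bar> * (M * dist x y) + \<bar>C\<bar> * (L * dist x y)"
      using B[OF xy(1)] C[OF xy(2)] lipschitz_onD[OF f xy] lipschitz_onD[OF g xy]
      by (intro add_mono mult_mono) (auto simp: dist_real_def)
    finally show "dist (f x * g x) (f y * g y) \<le> (\<bar>B\<bar> * M + \<bar>C\<bar> * L) * dist x y"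
      by (simp add: algebra_simps)
  qed (use LM in auto)
  then show ?thesis by blast
qed

lemma continuously_differentiable_imp_lipschitz_Icc:
  fixes f :: "real \<Rightarrow> 'a::euclidean_space"
  assumes der: "\<And>t. t \<in> {a..b} \<Longrightarrow> (f has_vector_derivative f' t) (at t within {a..b})"
    and cont: "continuous_on {a..b} f'"
  shows "\<exists>L. L-lipschitz_on {a..b} f"
proof -
  have "bounded (f' ` {a..b})"
    by (intro compact_imp_bounded compact_continuous_image cont compact_Icc)
  then obtain B where B: "\<And>t. t \<in> {a..b} \<Longrightarrow> norm (f' t) \<le> B" by (force simp: bounded_iff)
  have "\<bar>B\<bar>-lipschitz_on {a..b} f"
  proof (rule lipschitz_onI)
    fix x y assume xy: "x \<in> {a..b}" "y \<in> {a..b}"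
    have "norm (f x - f y) \<le> \<bar>B\<bar> * norm (x - y)"
    proof (rule differentiable_bound[OF _ _ _ xy])
      show "(f has_derivative (\<lambda>h. h *\<^sub>R f' t)) (at t within {a..b})" if "t \<in> {a..b}" for t
        using der[OF that] by (simp add: has_vector_derivative_def)
      show "onorm (\<lambda>h. h *\<^sub>R f' t) \<le> \<bar>B\<bar>" if "t \<in> {a..b}" for t
        using B[OF that] by (intro onorm_le) (simp add: mult.commute[of _ "norm (f' t)"] mult_right_mono)
    qed simp
    then show "dist (f x) (f y) \<le> \<bar>B\<bar> * dist x y" by (simp add: dist_norm)
  qed simp
  then show ?thesis by blast
qed

text \<open>Applied to \<open>h 4 + \<i> h 5\<close>, this bounds both coefficients of the density of the new parameter at
  once: they are the real and imaginary parts of the reciprocal.\<close>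

lemma lipschitz_on_inverse:
  fixes f :: "'a::metric_space \<Rightarrow> 'b::real_normed_field"
  assumes f: "L-lipschitz_on S f" and m: "m > 0" "\<And>x. x \<in> S \<Longrightarrow> m \<le> norm (f x)"
  shows "(L / m^2)-lipschitz_on S (\<lambda>x. inverse (f x))"
proof (rule lipschitz_onI)
  fix x y assume xy: "x \<in> S" "y \<in> S"
  have nz: "f x \<noteq> 0" "f y \<noteq> 0" using m(1) m(2)[OF xy(1)] m(2)[OF xy(2)] by auto
  have "dist (inverse (f x)) (inverse (f y)) = dist (f x) (f y) / (norm (f x) * norm (f y))"
    using nz by (simp add: dist_norm division_ring_inverse_diff norm_mult norm_divide
        norm_minus_commute[of "f y"] divide_simps)
  also have "\<dots> \<le> (L * dist x y) / (m * m)"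
    using m xy lipschitz_onD[OF f xy] using order_trans[OF zero_le_dist lipschitz_onD[OF f xy]]
    by (intro frac_le mult_mono) auto
  finally show "dist (inverse (f x)) (inverse (f y)) \<le> L / m^2 * dist x y"
    by (simp add: power2_eq_square)
qed (use f in \<open>auto simp: lipschitz_on_def\<close>)

section \<open>Vector-valued curves and a hyperbolic pair\<close>

lemma has_vector_derivative_vec_componentwise:
  fixes f :: "real \<Rightarrow> real^'n"
  shows "(f has_vector_derivative v) (at t within S) \<longleftrightarrow>
    (\<forall>i. ((\<lambda>x. f x $ i) has_real_derivative v $ i) (at t within S))"
  unfolding has_vector_derivative_def has_real_derivative_iff_has_vector_derivative
    has_derivative_componentwise_within[of f]
  by (auto simp: Basis_vec_def inner_axis)

lemma continuous_on_vec_componentwise: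
  fixes f :: "'a::topological_space \<Rightarrow> 'b::topological_space^'n"
  assumes "\<And>i. continuous_on S (\<lambda>x. f x $ i)"
  shows "continuous_on S f"
  using continuous_on_vec_lambda[of S "\<lambda>i x. f x $ i"] assms by simp

text \<open>If \<open>A\<^sup>2\<close> is \<open>k\<close> times the identity, then \<open>C s + S s A\<close> is the exponential of \<open>s A\<close>, with
  inverse \<open>C s - S s A\<close>.\<close>

lemma hyperbolic_pair_exists:
  fixes k :: real
  obtains C S :: "real \<Rightarrow> real" where "C 0 = 1" "S 0 = 0"
    "\<And>s. (C has_real_derivative k * S s) (at s)" "\<And>s. (S has_real_derivative C s) (at s)"
    "\<And>s. (C s)^2 - k * (S s)^2 = 1"
proof -
  consider "k = 0" | "k > 0" | "k < 0" by linarith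
  then show ?thesis
  proof cases
    case 1
    then show ?thesis
      by (intro that[of "\<lambda>s. 1" "\<lambda>s. s"]) (auto intro!: derivative_eq_intros)
  next
    case 2
    define w where "w = sqrt k"
    have w: "w \<noteq> 0" "k = w * w" using 2 by (auto simp: w_def)
    show ?thesis
      by (rule that[of "\<lambda>s. cosh (w * s)" "\<lambda>s. sinh (w * s) / w"])
        (use w in \<open>auto intro!: derivative_eq_intros simp: power_divide power2_eq_square
          cosh_square_eq[unfolded power2_eq_square]\<close>)
  next
    case 3
    define w where "w = sqrt (- k)"
    have w: "w \<noteq> 0" "k = - (w^2)" using 3 by (auto simp: w_def)
    have "(cos (w * s))^2 - k * (sin (w * s) / w)^2 = 1" for s
      using w by (simp add: power_divide)
    moreover have "((\<lambda>s. cos (w * s)) has_real_derivative k * (sin (w * s) / w)) (at s)"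
      "((\<lambda>s. sin (w * s) / w) has_real_derivative cos (w * s)) (at s)" for s
      using w by (auto intro!: derivative_eq_intros simp: power2_eq_square)
    ultimately show ?thesis
      by (intro that[of "\<lambda>s. cos (w * s)" "\<lambda>s. sin (w * s) / w"]) auto
  qed
qed

section \<open>Coordinates on the cotangent bundle\<close>

lemma vec_nth_lipschitz:
  fixes f :: "'a::metric_space \<Rightarrow> real^'n"
  assumes "L-lipschitz_on S f"
  shows "L-lipschitz_on S (\<lambda>x. f x $ i)"
proof -
  have "dist (f x $ i) (f y $ i) \<le> dist (f x) (f y)" for x y
    by (rule dist_vec_nth_le)
  then show ?thesis using assms unfolding lipschitz_on_def by (meson order_trans)
qed

lemma lipschitz_on_fst: "L-lipschitz_on S f \<Longrightarrow> L-lipschitz_on S (\<lambda>x. fst (f x))"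
  and lipschitz_on_snd: "L-lipschitz_on S f \<Longrightarrow> L-lipschitz_on S (\<lambda>x. snd (f x))"
  unfolding lipschitz_on_def by (meson dist_fst_le dist_snd_le order_trans)+

lemma h_lipschitz: "L-lipschitz_on S \<gamma> \<Longrightarrow> L-lipschitz_on S (\<lambda>t. h i (\<gamma> t))"
  unfolding h_def by (intro vec_nth_lipschitz lipschitz_on_fst)

lemma h_has_derivative:
  assumes "(\<gamma> has_vector_derivative w) (at t within S)"
  shows "((\<lambda>t. h i (\<gamma> t)) has_real_derivative h i w) (at t within S)"
    "((\<lambda>t. snd (\<gamma> t)) has_vector_derivative snd w) (at t within S)"
  using bounded_linear.has_vector_derivative[OF bounded_linear_fst assms]
    bounded_linear.has_vector_derivative[OF bounded_linear_snd assms]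
  by (simp_all add: has_vector_derivative_vec_componentwise h_def)

lemma cotangent_has_vector_derivative:
  assumes "\<And>i. ((\<lambda>t. h i (\<gamma> t)) has_real_derivative h i w) (at t within S)"
    and "((\<lambda>t. snd (\<gamma> t)) has_vector_derivative snd w) (at t within S)"
  shows "(\<gamma> has_vector_derivative w) (at t within S)"
proof -
  have "((\<lambda>t. fst (\<gamma> t)) has_vector_derivative fst w) (at t within S)"
    using assms(1) by (simp add: has_vector_derivative_vec_componentwise h_def)
  from has_vector_derivative_Pair[OF this assms(2)] show ?thesis by simp
qed

lemma h_hamiltonian_field:
  "h 1 (hamiltonian_field a b l) = - b * h 3 l" "h 2 (hamiltonian_field a b l) = a * h 3 l"
  "h 3 (hamiltonian_field a b l) = a * h 4 l + b * h 5 l"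
  "h 4 (hamiltonian_field a b l) = a * h 6 l + b * h 7 l"
  "h 5 (hamiltonian_field a b l) = a * h 7 l + b * h 8 l"
  "h 6 (hamiltonian_field a b l) = 0" "h 7 (hamiltonian_field a b l) = 0"
  "h 8 (hamiltonian_field a b l) = 0"
  "snd (hamiltonian_field a b l) = a *\<^sub>R X1 (snd l) + b *\<^sub>R X2 (snd l)"
  by (simp_all add: hamiltonian_field_def h_def)

lemma horizontal_coordinates:
  "(a *\<^sub>R X1 q + b *\<^sub>R X2 q) $ 1 = a" "(a *\<^sub>R X1 q + b *\<^sub>R X2 q) $ 2 = b"
  by (simp_all add: X_defs)

section \<open>Equations along abnormal extremals\<close>

text \<open>What the maximum principle amounts to once maximality has been exploited, stated on an arbitrary
  interval so that it applies to pieces of an extremal as well as to the modified covector of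
  \<open>degenerate_singular_curve\<close>.  The null set \<open>N\<close> is explicit because
  several almost everywhere statements are combined at the same times.\<close>

definition singular_curve ::
    "real \<Rightarrow> real \<Rightarrow> real set \<Rightarrow> (real \<Rightarrow> real) \<Rightarrow> (real \<Rightarrow> real) \<Rightarrow> (real \<Rightarrow> cotangent) \<Rightarrow> bool" where
  "singular_curve a b N u1 u2 \<gamma> \<longleftrightarrow> negligible N \<and> (\<exists>L. L-lipschitz_on {a..b} \<gamma>) \<and>
     (\<forall>t\<in>{a..b}. h 1 (\<gamma> t) = 0 \<and> h 2 (\<gamma> t) = 0 \<and> h 3 (\<gamma> t) = 0) \<and>
     (\<forall>t\<in>{a..b} - N. (u1 t \<noteq> 0 \<or> u2 t \<noteq> 0) \<and> u1 t * h 4 (\<gamma> t) + u2 t * h 5 (\<gamma> t) = 0 \<and>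
        (\<gamma> has_vector_derivative hamiltonian_field (u1 t) (u2 t) (\<gamma> t)) (at t within {a..b}))"

lemma singular_curve_subinterval:
  assumes "singular_curve a b N u1 u2 \<gamma>" "{c..d} \<subseteq> {a..b}"
  shows "singular_curve c d N u1 u2 \<gamma>"
  using assms unfolding singular_curve_def
  by (blast intro: lipschitz_on_subset has_vector_derivative_within_subset)

lemma has_real_derivative_vanishing_Icc:
  fixes f :: "real \<Rightarrow> real"
  assumes "(f has_real_derivative v) (at t within {a..b})" "a < b" "t \<in> {a..b}"
    and "\<And>x. x \<in> {a..b} \<Longrightarrow> f x = 0"
  shows "v = 0"
  using derivative_zero_at_limit_of_zeros[of f v t "{a..b}" "{a..b}"] assms by auto

lemma not_negligible_Icc: "a < b \<Longrightarrow> \<not> negligible {a..b::real}"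
  using negligible_interval(1)[of a b] by (simp add: box_real)

text \<open>Testing maximality with \<open>v = u + (h 1, h 2)\<close> gives \<open>(h 1)\<^sup>2 + (h 2)\<^sup>2 \<le> 0\<close>.  Differentiating
  the identities \<open>h 1 = h 2 = 0\<close> yields \<open>h 3 = 0\<close> almost everywhere, hence everywhere by continuity,
  and differentiating \<open>h 3 = 0\<close> yields the orthogonality of \<open>u\<close> and \<open>(h 4, h 5)\<close>.\<close>

lemma abnormal_extremal_imp_singular_curve:
  assumes "abnormal_extremal T \<gamma>"
  obtains N u1 u2 where "singular_curve 0 T N u1 u2 \<gamma>"
proof -
  obtain L u1 u2 c where T: "0 < T" and L: "L-lipschitz_on {0..T} \<gamma>" 
    and c: "c \<noteq> 0" "\<And>t. t \<in> {0..T} \<Longrightarrow> (u1 t)^2 + (u2 t)^2 = c"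
    and ae: "AE t in lebesgue_on {0..T}.
           (\<gamma> has_vector_derivative hamiltonian_field (u1 t) (u2 t) (\<gamma> t)) (at t within {0..T})"
    and max: "\<And>t v1 v2. t \<in> {0..T} \<Longrightarrow>
           v1 * h 1 (\<gamma> t) + v2 * h 2 (\<gamma> t) \<le> u1 t * h 1 (\<gamma> t) + u2 t * h 2 (\<gamma> t)"
    using assms unfolding abnormal_extremal_def constant_velocity_control_def by blast
  obtain N where N: "negligible N" and der: "\<And>t. t \<in> {0..T} - N \<Longrightarrow>
      (\<gamma> has_vector_derivative hamiltonian_field (u1 t) (u2 t) (\<gamma> t)) (at t within {0..T})"
    using ae by (subst (asm) AE_lebesgue_on_iff_negligible) auto
  have u: "u1 t \<noteq> 0 \<or> u2 t \<noteq> 0" if "t \<in> {0..T}" for t using c(1) c(2)[OF that] by auto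
  have h12: "h 1 (\<gamma> t) = 0" "h 2 (\<gamma> t) = 0" if t: "t \<in> {0..T}" for t
  proof -
    have "(h 1 (\<gamma> t))^2 + (h 2 (\<gamma> t))^2 \<le> 0"
      using max[OF t, of "u1 t + h 1 (\<gamma> t)" "u2 t + h 2 (\<gamma> t)"]
      by (simp add: algebra_simps power2_eq_square)
    then show "h 1 (\<gamma> t) = 0" "h 2 (\<gamma> t) = 0" by (simp_all add: sum_power2_le_zero_iff)
  qed
  have comp: "((\<lambda>t. h i (\<gamma> t)) has_real_derivative h i (hamiltonian_field (u1 t) (u2 t) (\<gamma> t)))
      (at t within {0..T})" if "t \<in> {0..T} - N" for t i
    using h_has_derivative(1)[OF der[OF that]] .
  have h3': "h 3 (\<gamma> t) = 0" if t: "t \<in> {0..T} - N" for t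
  proof -
    have "h 1 (hamiltonian_field (u1 t) (u2 t) (\<gamma> t)) = 0" "h 2 (hamiltonian_field (u1 t) (u2 t) (\<gamma> t)) = 0"
      using has_real_derivative_vanishing_Icc[OF comp[OF t] T _ h12(1)]
        has_real_derivative_vanishing_Icc[OF comp[OF t] T _ h12(2)] t by auto
    then show ?thesis using u[of t] t by (auto simp: h_hamiltonian_field)
  qed
  have h3: "h 3 (\<gamma> t) = 0" if t: "t \<in> {0..T}" for t
  proof (rule ccontr)
    assume nz: "h 3 (\<gamma> t) \<noteq> 0"
    have "continuous_on {0..T} (\<lambda>t. h 3 (\<gamma> t))"
      using h_lipschitz[OF L] lipschitz_on_continuous_on by blast
    then obtain e where e: "e > 0" "\<And>s. s \<in> {0..T} \<Longrightarrow> dist t s < e \<Longrightarrow> h 3 (\<gamma> s) \<noteq> 0"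
      using continuous_on_avoid[of "{0..T}" "\<lambda>t. h 3 (\<gamma> t)" t 0] t nz by blast
    have "{max 0 (t - e/2)..min T (t + e/2)} \<subseteq> N"
    proof
      fix s assume "s \<in> {max 0 (t - e/2)..min T (t + e/2)}"
      then have "s \<in> {0..T}" "dist t s < e" using e(1) by (auto simp: dist_real_def)
      then show "s \<in> N" using e(2) h3'[of s] by blast
    qed
    then have "negligible {max 0 (t - e/2)..min T (t + e/2)}" using N negligible_subset by blast
    moreover have "max 0 (t - e/2) < min T (t + e/2)" using t e(1) T by auto
    ultimately show False using not_negligible_Icc by blast
  qed
  have "u1 t * h 4 (\<gamma> t) + u2 t * h 5 (\<gamma> t) = 0" if t: "t \<in> {0..T} - N" for t
    using has_real_derivative_vanishing_Icc[OF comp[OF t, of 3] T _ h3] t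
    by (simp add: h_hamiltonian_field)
  then have "singular_curve 0 T N u1 u2 \<gamma>"
    unfolding singular_curve_def using N L h12 h3 u der by auto
  then show ?thesis by (rule that)
qed

lemma singular_curve_constants:
  assumes sing: "singular_curve a b N u1 u2 \<gamma>" and st: "s \<in> {a..b}" "t \<in> {a..b}"
  shows "h 6 (\<gamma> s) = h 6 (\<gamma> t)" "h 7 (\<gamma> s) = h 7 (\<gamma> t)" "h 8 (\<gamma> s) = h 8 (\<gamma> t)"
proof -
  obtain L where N: "negligible N" and L: "L-lipschitz_on {a..b} \<gamma>"
    and der: "\<And>t. t \<in> {a..b} - N \<Longrightarrow>
      (\<gamma> has_vector_derivative hamiltonian_field (u1 t) (u2 t) (\<gamma> t)) (at t within {a..b})"
    using sing unfolding singular_curve_def by blast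
  have "h i (\<gamma> s) = h i (\<gamma> t)"
    if "\<And>a b l. h i (hamiltonian_field a b l) = 0" for i
    using lipschitz_ae_derivative_zero_constant[OF h_lipschitz[OF L] N _ st] h_has_derivative(1)[OF der] that
    by metis
  then show "h 6 (\<gamma> s) = h 6 (\<gamma> t)" "h 7 (\<gamma> s) = h 7 (\<gamma> t)" "h 8 (\<gamma> s) = h 8 (\<gamma> t)"
    by (simp_all add: h_hamiltonian_field)
qed

section \<open>From reduced curves to abnormal extremals\<close>

lemma vector2_has_vector_derivative:
  "((\<lambda>s. vector [f s, g s] :: real^2) has_vector_derivative vector [f', g']) (at s within S) \<longleftrightarrow>
   (f has_real_derivative f') (at s within S) \<and> (g has_real_derivative g') (at s within S)"
  by (simp add: has_vector_derivative_vec_componentwise forall_2)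

lemma D_mult: "D l *v vector [x, y] = vector [h 7 l * x - h 6 l * y, h 8 l * x - h 7 l * y]"
  by (simp add: D_def matrix_vector_mult_def sum_2 vec_eq_iff forall_2)

text \<open>The reduced system is the Hamiltonian system with the feedback control \<open>(- h 5, h 4)\<close>.  This
  packs its equations into one derivative to which the chain rule applies.\<close>

lemma reduced_curve_hamiltonian:
  assumes "reduced_curve S \<mu>" "s \<in> S"
  shows "(\<mu> has_vector_derivative hamiltonian_field (- h 5 (\<mu> s)) (h 4 (\<mu> s)) (\<mu> s)) (at s within S)"
proof (rule cotangent_has_vector_derivative)
  note red = assms(1)[unfolded reduced_curve_def D_mult vector2_has_vector_derivative, rule_format, OF assms(2)]
  have z: "((\<lambda>t. h i (\<mu> t)) has_real_derivative 0) (at s within S)" if "i \<in> {1,2,3}" for i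
    by (rule has_field_derivative_transform_within[OF DERIV_const[of 0], of 1])
      (use assms that in \<open>auto simp: reduced_curve_def\<close>)
  show "((\<lambda>t. h i (\<mu> t)) has_real_derivative
      h i (hamiltonian_field (- h 5 (\<mu> s)) (h 4 (\<mu> s)) (\<mu> s))) (at s within S)" for i
    using exhaust_8[of i] red z[of i] by (auto simp: h_hamiltonian_field algebra_simps)
  show "((\<lambda>t. snd (\<mu> t)) has_vector_derivative
      snd (hamiltonian_field (- h 5 (\<mu> s)) (h 4 (\<mu> s)) (\<mu> s))) (at s within S)"
    using red by (simp add: h_hamiltonian_field)
qed

lemma continuous_on_X2: "continuous_on S f \<Longrightarrow> continuous_on S (\<lambda>t. X2 (f t))"
  using X_has_derivative(2) has_derivative_continuous
  by (intro continuous_on_compose2[of UNIV X2 S f] continuous_at_imp_continuous_on) blast+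

lemma hamiltonian_field_scale:
  "r *\<^sub>R hamiltonian_field a b l = hamiltonian_field (r * a) (r * b) l"
  by (simp add: hamiltonian_field_def vec_eq_8 algebra_simps)

lemma reduced_curve_lipschitz:
  assumes "reduced_curve {c..d} \<mu>"
  shows "\<exists>L. L-lipschitz_on {c..d} \<mu>"
proof (rule continuously_differentiable_imp_lipschitz_Icc[OF reduced_curve_hamiltonian[OF assms]])
  have mu: "continuous_on {c..d} \<mu>"
    using has_vector_derivative_continuous[OF reduced_curve_hamiltonian[OF assms]]
    by (simp add: continuous_on_eq_continuous_within)
  have hc: "continuous_on {c..d} (\<lambda>s. h i (\<mu> s))" for i
    unfolding h_def by (intro continuous_intros mu)
  have X1c: "continuous_on {c..d} (\<lambda>s. X1 (snd (\<mu> s)))" by (simp add: X1_def)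
  have "continuous_on {c..d} (\<lambda>s. fst (hamiltonian_field (- h 5 (\<mu> s)) (h 4 (\<mu> s)) (\<mu> s)))"
  proof (rule continuous_on_vec_componentwise)
    fix i :: 8
    show "continuous_on {c..d} (\<lambda>s. fst (hamiltonian_field (- h 5 (\<mu> s)) (h 4 (\<mu> s)) (\<mu> s)) $ i)"
      using exhaust_8[of i] unfolding h_def[symmetric]
      by (elim disjE; simp only: h_hamiltonian_field; intro continuous_intros hc)
  qed
  moreover have "continuous_on {c..d} (\<lambda>s. snd (hamiltonian_field (- h 5 (\<mu> s)) (h 4 (\<mu> s)) (\<mu> s)))"
    unfolding h_hamiltonian_field by (intro continuous_intros hc X1c continuous_on_X2 mu)
  ultimately show "continuous_on {c..d} (\<lambda>s. hamiltonian_field (- h 5 (\<mu> s)) (h 4 (\<mu> s)) (\<mu> s))"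
    using continuous_on_Pair by force
qed

text \<open>The velocity of the reparameterized curve is \<open>r\<close> times the Hamiltonian field for the control
  \<open>(- h 5, h 4)\<close>, that is, the field for \<open>r (- h 5, h 4)\<close>.  This is the given control \<open>u\<close>, as \<open>u\<close> is
  determined by the derivative of \<open>q\<close>.\<close>

lemma reparameterized_imp_abnormal_extremal:
  assumes T: "0 < T" and rep: "reparameterized_reduced_curve 0 T \<gamma>"
    and vel: "constant_velocity_trajectory T (\<lambda>t. snd (\<gamma> t))"
  shows "abnormal_extremal T \<gamma>"
proof -
  obtain \<mu> \<phi> c d where red: "reduced_curve {c..d} \<mu>" and pc: "param_change \<phi> 0 T c d"
    and \<gamma>: "\<And>t. t \<in> {0..T} \<Longrightarrow> \<gamma> t = \<mu> (\<phi> t)"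
    using rep unfolding reparameterized_reduced_curve_def by blast
  obtain L1 N1 where L1: "L1-lipschitz_on {0..T} \<phi>" and im: "\<phi> ` {0..T} = {c..d}"
    and N1: "negligible N1"
    and \<phi>: "\<And>t. t \<in> {0..T} - N1 \<Longrightarrow> \<exists>r. r \<noteq> 0 \<and> (\<phi> has_real_derivative r) (at t within {0..T})"
    using pc unfolding param_change_def by (subst (asm) AE_lebesgue_on_iff_negligible) auto
  obtain u1 u2 N2 where ctrl: "constant_velocity_control T u1 u2" and N2: "negligible N2"
    and q: "\<And>t. t \<in> {0..T} - N2 \<Longrightarrow> ((\<lambda>t. snd (\<gamma> t)) has_vector_derivative
        u1 t *\<^sub>R X1 (snd (\<gamma> t)) + u2 t *\<^sub>R X2 (snd (\<gamma> t))) (at t within {0..T})"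
    using vel unfolding constant_velocity_trajectory_def
    by (subst (asm) AE_lebesgue_on_iff_negligible) auto
  define N where "N = N1 \<union> N2"
  have N: "negligible N" using N1 N2 by (simp add: N_def)
  obtain L2 where L2: "L2-lipschitz_on {c..d} \<mu>" using reduced_curve_lipschitz[OF red] by blast
  have lip: "(L2 * L1)-lipschitz_on {0..T} \<gamma>"
  proof (rule lipschitz_on_transform)
    show "(L2 * L1)-lipschitz_on {0..T} (\<lambda>t. \<mu> (\<phi> t))"
      by (rule lipschitz_on_compose2[OF L1]) (use L2 im in simp)
  qed (use \<gamma> in simp)
  have zero: "h 1 (\<gamma> t) = 0 \<and> h 2 (\<gamma> t) = 0 \<and> h 3 (\<gamma> t) = 0" if "t \<in> {0..T}" for t
    using red \<gamma>[OF that] im that unfolding reduced_curve_def by auto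
  have main: "(\<gamma> has_vector_derivative hamiltonian_field (u1 t) (u2 t) (\<gamma> t)) (at t within {0..T}) \<and>
      (\<exists>r. u1 t = r * - h 5 (\<gamma> t) \<and> u2 t = r * h 4 (\<gamma> t))" if t: "t \<in> {0..T} - N" for t
  proof -
    obtain r where r: "(\<phi> has_real_derivative r) (at t within {0..T})" using \<phi>[of t] t by (auto simp: N_def)
    have "(\<mu> has_vector_derivative hamiltonian_field (- h 5 (\<mu> (\<phi> t))) (h 4 (\<mu> (\<phi> t))) (\<mu> (\<phi> t)))
        (at (\<phi> t) within \<phi> ` {0..T})"
      unfolding im by (rule reduced_curve_hamiltonian[OF red]) (use im t in auto)
    from vector_diff_chain_within[OF r[unfolded has_real_derivative_iff_has_vector_derivative] this]
    have "((\<lambda>t. \<mu> (\<phi> t)) has_vector_derivative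
        hamiltonian_field (r * - h 5 (\<gamma> t)) (r * h 4 (\<gamma> t)) (\<gamma> t)) (at t within {0..T})"
      using t \<gamma> by (simp add: hamiltonian_field_scale o_def)
    then have der: "(\<gamma> has_vector_derivative
        hamiltonian_field (r * - h 5 (\<gamma> t)) (r * h 4 (\<gamma> t)) (\<gamma> t)) (at t within {0..T})"
      by (rule has_vector_derivative_transform[rotated 2]) (use t \<gamma> in auto)
    have "snd (hamiltonian_field (r * - h 5 (\<gamma> t)) (r * h 4 (\<gamma> t)) (\<gamma> t)) =
        u1 t *\<^sub>R X1 (snd (\<gamma> t)) + u2 t *\<^sub>R X2 (snd (\<gamma> t))"
      by (rule vector_derivative_unique_within_closed_interval[OF T _
            h_has_derivative(2)[OF der, folded box_real(2)] q[folded box_real(2)]])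
        (use t in \<open>auto simp: N_def box_real\<close>)
    then have u: "u1 t = r * - h 5 (\<gamma> t)" "u2 t = r * h 4 (\<gamma> t)"
      unfolding h_hamiltonian_field by (metis horizontal_coordinates)+
    then show ?thesis using der by auto
  qed
  have "\<exists>t\<in>{0..T} - N. True"
  proof (rule ccontr)
    assume "\<not> ?thesis"
    then have "negligible {0..T}" using N negligible_subset by blast
    then show False using not_negligible_Icc[OF T] by blast
  qed
  then obtain t0 where t0: "t0 \<in> {0..T} - N" by blast
  have "u1 t0 \<noteq> 0 \<or> u2 t0 \<noteq> 0"
    using ctrl t0 unfolding constant_velocity_control_def by force
  then have nz0: "\<not> (h 4 (\<gamma> t0) = 0 \<and> h 5 (\<gamma> t0) = 0)" using main[OF t0] by auto
  have nontriv: "fst (\<gamma> t) \<noteq> 0" if t: "t \<in> {0..T}" for t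
  proof
    assume "fst (\<gamma> t) = 0"
    then have "h 4 (\<mu> (\<phi> t)) = 0" "h 5 (\<mu> (\<phi> t)) = 0" using \<gamma>[OF t] by (auto simp: h_def)
    then have "h 4 (\<mu> (\<phi> t0)) = 0 \<and> h 5 (\<mu> (\<phi> t0)) = 0"
      using reduced_curve_equilibrium[OF red, of "\<phi> t" "\<phi> t0"] im t t0 by blast
    then show False using nz0 \<gamma>[of t0] t0 by auto
  qed
  have "AE t in lebesgue_on {0..T}.
      (\<gamma> has_vector_derivative hamiltonian_field (u1 t) (u2 t) (\<gamma> t)) (at t within {0..T})"
    using N main by (subst AE_lebesgue_on_iff_negligible) auto
  then show ?thesis unfolding abnormal_extremal_def using T lip ctrl nontriv zero by auto
qed


section \<open>From abnormal extremals to reduced curves\<close>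

text \<open>A curve whose velocity is \<open>r\<close> times that of the reduced system factors through a primitive
  \<open>\<phi>\<close> of \<open>r\<close>.  Since \<open>\<phi>\<close> need not be injective, the factor \<open>\<mu>\<close> cannot be read off from
  \<open>\<gamma>\<close>; it is constructed from the initial value \<open>\<gamma> a\<close> at the parameter \<open>\<phi> a\<close>, and the two
  curves are compared by means of Lipschitz functions with almost everywhere zero derivative.\<close>

lemma reparameterization_of_scaled_flow:
  assumes "a < b" and L: "L-lipschitz_on {a..b} \<gamma>" and K: "K-lipschitz_on {a..b} \<phi>"
    and N: "negligible N"
    and zero: "\<And>t. t \<in> {a..b} \<Longrightarrow> h 1 (\<gamma> t) = 0 \<and> h 2 (\<gamma> t) = 0 \<and> h 3 (\<gamma> t) = 0"
    and \<phi>: "\<And>t. t \<in> {a..b} - N \<Longrightarrow> r t \<noteq> 0 \<and> (\<phi> has_real_derivative r t) (at t within {a..b})"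
    and \<gamma>: "\<And>t. t \<in> {a..b} - N \<Longrightarrow> (\<gamma> has_vector_derivative
        hamiltonian_field (r t * - h 5 (\<gamma> t)) (r t * h 4 (\<gamma> t)) (\<gamma> t)) (at t within {a..b})"
  shows "reparameterized_reduced_curve a b \<gamma>"
proof -
  have ab: "a \<in> {a..b}" using \<open>a < b\<close> by simp
  define m6 m7 m8 where "m6 = h 6 (\<gamma> a)" and "m7 = h 7 (\<gamma> a)" and "m8 = h 8 (\<gamma> a)"
  \<comment> \<open>The square of the constant matrix \<open>D\<close> is \<open>k\<close> times the identity.\<close>
  define k where "k = m7^2 - m6 * m8"
  define x0 y0 where "x0 = h 4 (\<gamma> a)" and "y0 = h 5 (\<gamma> a)"
  define s0 where "s0 = \<phi> a"
  have der: "((\<lambda>t. h i (\<gamma> t)) has_real_derivative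
      h i (hamiltonian_field (r t * - h 5 (\<gamma> t)) (r t * h 4 (\<gamma> t)) (\<gamma> t))) (at t within {a..b})"
    if "t \<in> {a..b} - N" for t i
    using h_has_derivative(1)[OF \<gamma>[OF that]] .
  have hconst: "h i (\<gamma> t) = h i (\<gamma> a)" if "\<And>a b l. h i (hamiltonian_field a b l) = 0" "t \<in> {a..b}" for t i
    using lipschitz_ae_derivative_zero_constant[OF h_lipschitz[OF L] N _ that(2) ab] der that(1) by metis
  have const: "h 6 (\<gamma> t) = m6" "h 7 (\<gamma> t) = m7" "h 8 (\<gamma> t) = m8" if "t \<in> {a..b}" for t
    unfolding m6_def m7_def m8_def by (rule hconst; use that in \<open>simp add: h_hamiltonian_field\<close>)+
  have "continuous_on {a..b} \<phi>" using K lipschitz_on_continuous_on by blast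
  then obtain c d where im: "\<phi> ` {a..b} = {c..d}" and "c \<le> d"
    using continuous_image_closed_interval[of a b \<phi>] \<open>a < b\<close> by auto
  have s0: "s0 \<in> {c..d}" using im ab by (auto simp: s0_def)
  have \<phi>in: "\<phi> t \<in> {c..d}" if "t \<in> {a..b}" for t using im that by blast
  have chain: "((\<lambda>t. p (\<phi> t)) has_vector_derivative r t *\<^sub>R p' (\<phi> t)) (at t within {a..b})"
    if "t \<in> {a..b} - N" "\<And>s. s \<in> {c..d} \<Longrightarrow> (p has_vector_derivative p' s) (at s within {c..d})"
    for t and p p' :: "real \<Rightarrow> 'a::real_normed_vector"
  proof -
    have "(p has_vector_derivative p' (\<phi> t)) (at (\<phi> t) within \<phi> ` {a..b})"
      unfolding im using that \<phi>in by blast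
    then show ?thesis
      using vector_diff_chain_within[of \<phi> "r t" t "{a..b}" p] \<phi>[OF that(1)]
      by (simp add: has_real_derivative_iff_has_vector_derivative o_def)
  qed
  have lipchain: "\<exists>M. M-lipschitz_on {a..b} (\<lambda>t. p (\<phi> t))"
    if "\<And>s. s \<in> {c..d} \<Longrightarrow> (p has_vector_derivative p' s) (at s within {c..d})" "continuous_on {c..d} p'"
    for p p' :: "real \<Rightarrow> 'a::euclidean_space"
    using continuously_differentiable_imp_lipschitz_Icc[OF that] lipschitz_on_compose2[OF K] im by metis

  obtain C S where C0: "C 0 = (1::real)" and S0: "S 0 = (0::real)"
    and C: "\<And>s. (C has_real_derivative k * S s) (at s)"
    and S: "\<And>s. (S has_real_derivative C s) (at s)" and CS: "\<And>s. (C s)^2 - k * (S s)^2 = 1"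
    using hyperbolic_pair_exists by blast
  define C' where "C' s = C (s - s0)" for s
  define S' where "S' s = S (s - s0)" for s
  have C': "(C' has_real_derivative k * S' s) (at s within A)"
    and S': "(S' has_real_derivative C' s) (at s within A)" for s A
  proof -
    have shift: "((\<lambda>s. s - s0) has_real_derivative 1) (at s within A)"
      by (auto intro!: derivative_eq_intros)
    show "(C' has_real_derivative k * S' s) (at s within A)" "(S' has_real_derivative C' s) (at s within A)"
      using DERIV_chain2[OF C shift] DERIV_chain2[OF S shift] by (simp_all add: C'_def[abs_def] S'_def[abs_def])
  qed
  have CS': "(C' s)^2 - k * (S' s)^2 = 1" for s using CS by (simp add: C'_def S'_def)
  have C'c: "continuous_on A C'" and S'c: "continuous_on A S'" for A
    by (rule DERIV_continuous_on[OF C'], rule DERIV_continuous_on[OF S'])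
  define x where "x s = C' s * x0 + S' s * (m7 * x0 - m6 * y0)" for s
  define y where "y s = C' s * y0 + S' s * (m8 * x0 - m7 * y0)" for s
  have xder: "(x has_real_derivative m7 * x s - m6 * y s) (at s within A)"
    and yder: "(y has_real_derivative m8 * x s - m7 * y s) (at s within A)" for s A
    unfolding x_def y_def
    by (auto intro!: derivative_eq_intros C' S' simp: k_def algebra_simps power2_eq_square)
  have xc: "continuous_on A x" and yc: "continuous_on A y" for A
    by (rule DERIV_continuous_on[OF xder], rule DERIV_continuous_on[OF yder])

  have hx: "h 4 (\<gamma> t) = x (\<phi> t)" "h 5 (\<gamma> t) = y (\<phi> t)" if t: "t \<in> {a..b}" for t
  proof -
    note C'v = C'[unfolded has_real_derivative_iff_has_vector_derivative]
      and S'v = S'[unfolded has_real_derivative_iff_has_vector_derivative]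
    obtain LC LS where LC: "LC-lipschitz_on {a..b} (\<lambda>t. C' (\<phi> t))"
      and LS: "LS-lipschitz_on {a..b} (\<lambda>t. S' (\<phi> t))"
      using lipchain[OF C'v continuous_on_mult_left[OF S'c]] lipchain[OF S'v C'c] by blast
    define v where "v t = h 4 (\<gamma> t)" for t
    define w where "w t = h 5 (\<gamma> t)" for t
    define V where "V t = m7 * v t - m6 * w t" for t
    define W where "W t = m8 * v t - m7 * w t" for t
    have Lv: "L-lipschitz_on {a..b} v" and Lw: "L-lipschitz_on {a..b} w"
      unfolding v_def w_def by (rule h_lipschitz[OF L])+
    have "\<exists>M. M-lipschitz_on {a..b} V" "\<exists>M. M-lipschitz_on {a..b} W"
      unfolding V_def W_def
      using lipschitz_on_diff[OF lipschitz_on_cmult_real[OF Lv] lipschitz_on_cmult_real[OF Lw]] by blast+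
    then obtain LV LW where LV: "LV-lipschitz_on {a..b} V" and LW: "LW-lipschitz_on {a..b} W" by blast
    \<comment> \<open>The pull-back of \<open>(h 4, h 5)\<close> by the flow, which is constant along \<open>\<gamma>\<close>.\<close>
    define e where "e t = C' (\<phi> t) * v t - S' (\<phi> t) * V t" for t
    define f where "f t = C' (\<phi> t) * w t - S' (\<phi> t) * W t" for t
    have Le: "\<exists>M. M-lipschitz_on {a..b} e" and Lf: "\<exists>M. M-lipschitz_on {a..b} f"
      unfolding e_def f_def
      using lipschitz_on_mult_Icc[OF LC Lv] lipschitz_on_mult_Icc[OF LS LV]
        lipschitz_on_mult_Icc[OF LC Lw] lipschitz_on_mult_Icc[OF LS LW] lipschitz_on_diff by blast+
    have "(e has_real_derivative 0) (at t within {a..b})" "(f has_real_derivative 0) (at t within {a..b})"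
      if t: "t \<in> {a..b} - N" for t
    proof -
      have C1: "((\<lambda>t. C' (\<phi> t)) has_real_derivative r t * (k * S' (\<phi> t))) (at t within {a..b})"
        and S1: "((\<lambda>t. S' (\<phi> t)) has_real_derivative r t * C' (\<phi> t)) (at t within {a..b})"
        using chain[OF t C'v] chain[OF t S'v]
        by (simp_all add: has_real_derivative_iff_has_vector_derivative)
      have v1: "(v has_real_derivative r t * V t) (at t within {a..b})"
        and w1: "(w has_real_derivative r t * W t) (at t within {a..b})"
        using der[OF t, of 4] der[OF t, of 5] const[of t] t
        by (simp_all add: v_def[abs_def] w_def[abs_def] V_def W_def h_hamiltonian_field algebra_simps)
      have V1: "(V has_real_derivative r t * k * v t) (at t within {a..b})"
        and W1: "(W has_real_derivative r t * k * w t) (at t within {a..b})"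
        unfolding V_def[abs_def] W_def[abs_def]
        by (auto intro!: derivative_eq_intros v1 w1 simp: V_def W_def k_def algebra_simps power2_eq_square)
      show "(e has_real_derivative 0) (at t within {a..b})" "(f has_real_derivative 0) (at t within {a..b})"
        unfolding e_def[abs_def] f_def[abs_def]
        by (auto intro!: derivative_eq_intros C1 S1 v1 w1 V1 W1 simp: algebra_simps)
    qed
    then have "e t = e a" "f t = f a"
      using Le Lf lipschitz_ae_derivative_zero_constant[OF _ N _ t ab] by blast+
    then have ef: "e t = x0" "f t = y0"
      using C0 S0 by (auto simp: e_def f_def C'_def S'_def s0_def x0_def y0_def v_def w_def)
    have "x (\<phi> t) = ((C' (\<phi> t))^2 - k * (S' (\<phi> t))^2) * v t"
      unfolding x_def ef[symmetric] e_def f_def V_def W_def k_def by algebra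
    then show "h 4 (\<gamma> t) = x (\<phi> t)" by (simp add: CS' v_def)
    have "y (\<phi> t) = ((C' (\<phi> t))^2 - k * (S' (\<phi> t))^2) * w t"
      unfolding y_def ef[symmetric] e_def f_def V_def W_def k_def by algebra
    then show "h 5 (\<gamma> t) = y (\<phi> t)" by (simp add: CS' w_def)
  qed

  define q where "q t = snd (\<gamma> t)" for t
  have Lq: "L-lipschitz_on {a..b} q" unfolding q_def by (rule lipschitz_on_snd[OF L])
  have qder: "(q has_vector_derivative
      r t *\<^sub>R (- y (\<phi> t) *\<^sub>R X1 (q t) + x (\<phi> t) *\<^sub>R X2 (q t))) (at t within {a..b})"
    if t: "t \<in> {a..b} - N" for t
    using h_has_derivative(2)[OF \<gamma>[OF t]] hx t
    by (simp add: h_hamiltonian_field q_def[abs_def] algebra_simps)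
  have primitive: "\<exists>P. P s0 = v0 \<and> (\<forall>s\<in>{c..d}. (P has_vector_derivative f s) (at s within {c..d}))"
    if f: "continuous_on {c..d} f" for f :: "real \<Rightarrow> 'a::banach" and v0
  proof -
    obtain P where P: "\<And>s. s \<in> {c..d} \<Longrightarrow> (P has_vector_derivative f s) (at s within {c..d})"
      using antiderivative_continuous[OF f] by blast
    show ?thesis
      by (rule exI[of _ "\<lambda>s. P s + (v0 - P s0)"]) (auto intro!: derivative_eq_intros P)
  qed
  have follow: "q' t = P (\<phi> t)"
    if f: "continuous_on {c..d} f" and P0: "P s0 = q' a"
      and P: "\<forall>s\<in>{c..d}. (P has_vector_derivative f s) (at s within {c..d})"
      and lip: "M-lipschitz_on {a..b} q'"
      and der: "\<And>t. t \<in> {a..b} - N \<Longrightarrow> (q' has_vector_derivative r t *\<^sub>R f (\<phi> t)) (at t within {a..b})"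
      and t: "t \<in> {a..b}"
    for f P q' :: "real \<Rightarrow> 'a::euclidean_space" and M t
  proof -
    obtain M' where M': "M'-lipschitz_on {a..b} (\<lambda>t. P (\<phi> t))" using lipchain[OF _ f] P by blast
    have "((\<lambda>t. q' t - P (\<phi> t)) has_vector_derivative 0) (at t within {a..b})"
      if "t \<in> {a..b} - N" for t
      using has_vector_derivative_diff[OF der[OF that] chain[OF that]] P by fastforce
    from lipschitz_ae_derivative_zero_constant_vector[OF lipschitz_on_diff[OF lip M'] N this t ab]
    show ?thesis using P0 by (simp add: s0_def)
  qed
  \<comment> \<open>\<open>X1\<close> and \<open>X2\<close> depend on the first two coordinates only.  So these two are integrated first,
    after which all coordinates of \<open>Q\<close> are primitives of known functions.\<close>
  obtain p1 where p1: "p1 s0 = q a $ 1"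
      "\<forall>s\<in>{c..d}. (p1 has_vector_derivative - y s) (at s within {c..d})"
    using primitive[of "\<lambda>s. - y s"] continuous_on_minus[OF yc] by blast
  obtain p2 where p2: "p2 s0 = q a $ 2"
      "\<forall>s\<in>{c..d}. (p2 has_vector_derivative x s) (at s within {c..d})"
    using primitive[OF xc] by blast
  have q12: "q t $ 1 = p1 (\<phi> t)" "q t $ 2 = p2 (\<phi> t)" if t: "t \<in> {a..b}" for t
  proof -
    have "((\<lambda>t. q t $ 1) has_vector_derivative r t *\<^sub>R - y (\<phi> t)) (at t within {a..b})"
      "((\<lambda>t. q t $ 2) has_vector_derivative r t *\<^sub>R x (\<phi> t)) (at t within {a..b})"
      if "t \<in> {a..b} - N" for t
      using bounded_linear.has_vector_derivative[OF bounded_linear_vec_nth[of 1] qder[OF that]]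
        bounded_linear.has_vector_derivative[OF bounded_linear_vec_nth[of 2] qder[OF that]]
      by (simp_all only: vector_scaleR_component horizontal_coordinates)
    then show "q t $ 1 = p1 (\<phi> t)" "q t $ 2 = p2 (\<phi> t)"
      using follow[OF continuous_on_minus[OF yc] p1 vec_nth_lipschitz[OF Lq] _ t]
        follow[OF xc p2 vec_nth_lipschitz[OF Lq] _ t] by blast+
  qed
  define w where "w s = (p1 s *\<^sub>R axis 1 1 + p2 s *\<^sub>R axis 2 1 :: real^8)" for s
  have X2w: "X2 v = X2 (w s)" if "v $ 1 = p1 s" "v $ 2 = p2 s" for v s
    using that by (simp add: X2_def w_def axis_def)
  have X1w: "X1 v = X1 (w s)" for v s by (simp add: X1_def)
  define G where "G s = - y s *\<^sub>R X1 (w s) + x s *\<^sub>R X2 (w s)" for s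
  have "continuous_on {c..d} p1" "continuous_on {c..d} p2"
    using p1(2) p2(2) has_vector_derivative_continuous continuous_on_eq_continuous_within by blast+
  then have "continuous_on {c..d} w" unfolding w_def by (intro continuous_intros)
  then have Gc: "continuous_on {c..d} G"
    unfolding G_def by (intro continuous_intros xc yc continuous_on_X2) (auto simp: X1_def)
  obtain Q where Q: "Q s0 = q a" "\<forall>s\<in>{c..d}. (Q has_vector_derivative G s) (at s within {c..d})"
    using primitive[OF Gc] by blast
  have qQ: "q t = Q (\<phi> t)" if t: "t \<in> {a..b}" for t
  proof (rule follow[OF Gc Q Lq _ t])
    fix t assume t: "t \<in> {a..b} - N"
    show "(q has_vector_derivative r t *\<^sub>R G (\<phi> t)) (at t within {a..b})"
      using qder[OF t] X1w[of "q t" "\<phi> t"] X2w[of "q t" "\<phi> t"] q12[of t] t by (simp add: G_def)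
  qed
  \<comment> \<open>On \<open>{c..d}\<close> the first two coordinates of \<open>Q\<close> are \<open>p1\<close> and \<open>p2\<close>, because \<open>\<phi>\<close> is onto.\<close>
  have GQ: "G s = - y s *\<^sub>R X1 (Q s) + x s *\<^sub>R X2 (Q s)" if "s \<in> {c..d}" for s
  proof -
    obtain t where t: "t \<in> {a..b}" "s = \<phi> t" using im \<open>s \<in> {c..d}\<close> by blast
    then show ?thesis
      using X1w[of "Q s" s] X2w[of "Q s" s] q12[of t] qQ[of t] by (simp add: G_def)
  qed

  define \<mu> :: "real \<Rightarrow> cotangent" where "\<mu> s = (vector [0, 0, 0, x s, y s, m6, m7, m8], Q s)" for s
  have h\<mu>: "h 1 (\<mu> s) = 0" "h 2 (\<mu> s) = 0" "h 3 (\<mu> s) = 0" "h 4 (\<mu> s) = x s" "h 5 (\<mu> s) = y s"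
    "h 6 (\<mu> s) = m6" "h 7 (\<mu> s) = m7" "h 8 (\<mu> s) = m8" "snd (\<mu> s) = Q s" for s
    by (simp_all add: \<mu>_def h_def)
  have "reduced_curve {c..d} \<mu>"
    unfolding reduced_curve_def h\<mu> D_mult vector2_has_vector_derivative
    using xder yder Q(2) GQ by auto
  moreover have "AE t in lebesgue_on {a..b}. \<exists>r. r \<noteq> 0 \<and> (\<phi> has_real_derivative r) (at t within {a..b})"
    by (subst AE_lebesgue_on_iff_negligible, simp) (use N \<phi> in blast)
  then have "param_change \<phi> a b c d" unfolding param_change_def using K im by blast
  moreover have "\<gamma> t = \<mu> (\<phi> t)" if t: "t \<in> {a..b}" for t
    using zero[OF t] hx[OF t] const[OF t] qQ[OF t] 
    by (simp add: prod_eq_iff \<mu>_def vec_eq_8 h_def q_def)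
  ultimately show ?thesis unfolding reparameterized_reduced_curve_def by blast
qed

text \<open>Solving \<open>u = r (- h 5, h 4)\<close> gives \<open>r = (u2 h 4 - u1 h 5) / ((h 4)\<^sup>2 + (h 5)\<^sup>2)\<close>.  With
  \<open>W = h 4 + \<i> h 5\<close> the coefficients of \<open>u1\<close> and \<open>u2\<close> are the imaginary and the real part of \<open>1 / W\<close>,
  and \<open>u1\<close>, \<open>u2\<close> are the derivatives of the first two coordinates of \<open>q\<close>; so \<open>r\<close> has a primitive by
  \<open>lipschitz_stieltjes_primitive\<close>.\<close>

lemma singular_curve_reparameterized:
  assumes "a < b" and sing: "singular_curve a b N u1 u2 \<gamma>"
    and nz: "\<And>t. t \<in> {a..b} \<Longrightarrow> \<not> (h 4 (\<gamma> t) = 0 \<and> h 5 (\<gamma> t) = 0)"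
  shows "reparameterized_reduced_curve a b \<gamma>"
proof -
  obtain L where N: "negligible N" and L: "L-lipschitz_on {a..b} \<gamma>"
    and zero: "\<And>t. t \<in> {a..b} \<Longrightarrow> h 1 (\<gamma> t) = 0 \<and> h 2 (\<gamma> t) = 0 \<and> h 3 (\<gamma> t) = 0"
    and u: "\<And>t. t \<in> {a..b} - N \<Longrightarrow> u1 t \<noteq> 0 \<or> u2 t \<noteq> 0"
    and orth: "\<And>t. t \<in> {a..b} - N \<Longrightarrow> u1 t * h 4 (\<gamma> t) + u2 t * h 5 (\<gamma> t) = 0"
    and der: "\<And>t. t \<in> {a..b} - N \<Longrightarrow>
      (\<gamma> has_vector_derivative hamiltonian_field (u1 t) (u2 t) (\<gamma> t)) (at t within {a..b})"
    using sing unfolding singular_curve_def by blast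
  define W where "W t = Complex (h 4 (\<gamma> t)) (h 5 (\<gamma> t))" for t
  have W0: "W t \<noteq> 0" if "t \<in> {a..b}" for t using nz[OF that] by (simp add: W_def complex_eq_iff)
  have LW: "(2 * L)-lipschitz_on {a..b} W"
  proof (rule lipschitz_onI)
    fix s t assume st: "s \<in> {a..b}" "t \<in> {a..b}"
    have "dist (W s) (W t) \<le> \<bar>Re (W s - W t)\<bar> + \<bar>Im (W s - W t)\<bar>"
      unfolding dist_norm by (rule cmod_le)
    also have "\<dots> \<le> L * dist s t + L * dist s t"
      using lipschitz_onD[OF h_lipschitz[OF L] st, of 4] lipschitz_onD[OF h_lipschitz[OF L] st, of 5]
      by (simp add: W_def dist_real_def)
    finally show "dist (W s) (W t) \<le> 2 * L * dist s t" by simp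
  qed (use L in \<open>simp add: lipschitz_on_def\<close>)
  have "continuous_on {a..b} (\<lambda>t. norm (W t))"
    using LW lipschitz_on_continuous_on by (intro continuous_on_norm) blast
  then obtain t0 where t0: "t0 \<in> {a..b}" "\<And>t. t \<in> {a..b} \<Longrightarrow> norm (W t0) \<le> norm (W t)"
    using continuous_attains_inf[of "{a..b}" "\<lambda>t. norm (W t)"] \<open>a < b\<close> by auto
  define M where "M = 2 * L / (norm (W t0))^2"
  have LI: "M-lipschitz_on {a..b} (\<lambda>t. inverse (W t))"
    unfolding M_def by (rule lipschitz_on_inverse[OF LW]) (use t0 W0 in auto)
  have LRe: "M-lipschitz_on {a..b} (\<lambda>t. Re (inverse (W t)))"
    and LIm: "M-lipschitz_on {a..b} (\<lambda>t. Im (inverse (W t)))"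
  proof -
    have "dist (Re z) (Re w) \<le> dist z w" "dist (Im z) (Im w) \<le> dist z w" for z w
      using abs_Re_le_cmod[of "z - w"] abs_Im_le_cmod[of "z - w"] by (simp_all add: dist_norm)
    then show "M-lipschitz_on {a..b} (\<lambda>t. Re (inverse (W t)))"
      "M-lipschitz_on {a..b} (\<lambda>t. Im (inverse (W t)))"
      using LI unfolding lipschitz_on_def by (meson order_trans)+
  qed
  have Lq: "L-lipschitz_on {a..b} (\<lambda>t. snd (\<gamma> t) $ i)" for i
    by (rule vec_nth_lipschitz[OF lipschitz_on_snd[OF L]])
  have q: "((\<lambda>t. snd (\<gamma> t) $ 1) has_real_derivative u1 t) (at t within {a..b})"
    "((\<lambda>t. snd (\<gamma> t) $ 2) has_real_derivative u2 t) (at t within {a..b})" if "t \<in> {a..b} - N" for t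
    using h_has_derivative(2)[OF der[OF that]]
    unfolding has_vector_derivative_vec_componentwise h_hamiltonian_field
    by (metis horizontal_coordinates)+
  obtain \<phi>1 K1 where \<phi>1: "K1-lipschitz_on {a..b} \<phi>1"
    "\<And>t. t \<in> {a..b} - N \<Longrightarrow> (\<phi>1 has_real_derivative Im (inverse (W t)) * u1 t) (at t within {a..b})"
    using lipschitz_stieltjes_primitive[OF \<open>a < b\<close> Lq LIm N q(1)] by blast
  obtain \<phi>2 K2 where \<phi>2: "K2-lipschitz_on {a..b} \<phi>2"
    "\<And>t. t \<in> {a..b} - N \<Longrightarrow> (\<phi>2 has_real_derivative Re (inverse (W t)) * u2 t) (at t within {a..b})"
    using lipschitz_stieltjes_primitive[OF \<open>a < b\<close> Lq LRe N q(2)] by blast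
  define r where "r t = Im (inverse (W t)) * u1 t + Re (inverse (W t)) * u2 t" for t
  have ur: "u1 t = r t * - h 5 (\<gamma> t)" "u2 t = r t * h 4 (\<gamma> t)" if t: "t \<in> {a..b} - N" for t
  proof -
    define n where "n = (h 4 (\<gamma> t))^2 + (h 5 (\<gamma> t))^2"
    have n: "n \<noteq> 0" using nz[of t] t by (auto simp: n_def sum_power2_eq_zero_iff)
    have r: "r t * n = u2 t * h 4 (\<gamma> t) - u1 t * h 5 (\<gamma> t)"
      using n by (simp add: r_def W_def flip: n_def) (simp add: field_simps)
    have "u1 t * n = (u2 t * h 4 (\<gamma> t) - u1 t * h 5 (\<gamma> t)) * - h 5 (\<gamma> t)"
      using orth[OF t] unfolding n_def by algebra
    moreover have "u2 t * n = (u2 t * h 4 (\<gamma> t) - u1 t * h 5 (\<gamma> t)) * h 4 (\<gamma> t)"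
      using orth[OF t] unfolding n_def by algebra
    ultimately have "u1 t * n = (r t * n) * - h 5 (\<gamma> t)" "u2 t * n = (r t * n) * h 4 (\<gamma> t)"
      unfolding r by blast+
    then have "(u1 t - r t * - h 5 (\<gamma> t)) * n = 0" "(u2 t - r t * h 4 (\<gamma> t)) * n = 0" by algebra+
    then show "u1 t = r t * - h 5 (\<gamma> t)" "u2 t = r t * h 4 (\<gamma> t)" using n by simp_all
  qed
  show ?thesis
  proof (rule reparameterization_of_scaled_flow[OF \<open>a < b\<close> L lipschitz_on_add[OF \<phi>1(1) \<phi>2(1)] N zero])
    fix t assume t: "t \<in> {a..b} - N"
    show "r t \<noteq> 0 \<and> ((\<lambda>t. \<phi>1 t + \<phi>2 t) has_real_derivative r t) (at t within {a..b})"
    proof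
      show "r t \<noteq> 0" using u[OF t] ur[OF t] by (metis mult_zero_left)
      show "((\<lambda>t. \<phi>1 t + \<phi>2 t) has_real_derivative r t) (at t within {a..b})"
        using DERIV_add[OF \<phi>1(2)[OF t] \<phi>2(2)[OF t]] by (simp add: r_def)
    qed
    show "(\<gamma> has_vector_derivative hamiltonian_field (r t * - h 5 (\<gamma> t)) (r t * h 4 (\<gamma> t)) (\<gamma> t))
        (at t within {a..b})"
      using der[OF t] ur[OF t] by simp
  qed
qed

text \<open>An accumulation point \<open>t0\<close> of the zero set forces the constant matrix
  \<open>M = ((m6, m7), (m7, m8))\<close> to be singular.  By \<open>M\<^sup>2 = (m6 + m8) M\<close> and the orthogonality relation,
  \<open>(h 4, h 5)\<close> then vanishes identically, so the control lies in the line \<open>ker M\<close>.  Nontriviality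
  enters through \<open>M \<noteq> 0\<close>.\<close>

lemma degenerate_singular_curve:
  assumes T: "0 < T" and sing: "singular_curve 0 T N u1 u2 \<gamma>"
    and nontriv: "\<And>t. t \<in> {0..T} \<Longrightarrow> fst (\<gamma> t) \<noteq> 0"
    and Z: "\<not> negligible {t \<in> {0..T}. h 4 (\<gamma> t) = 0 \<and> h 5 (\<gamma> t) = 0}" (is "\<not> negligible ?Z")
  shows "(\<forall>t\<in>{0..T}. h 4 (\<gamma> t) = 0 \<and> h 5 (\<gamma> t) = 0) \<and>
         (\<exists>\<gamma>'. reparameterized_reduced_curve 0 T \<gamma>' \<and>
            (\<forall>t\<in>{0..T}. snd (\<gamma>' t) = snd (\<gamma> t) \<and>
               (\<forall>i. i \<noteq> 4 \<and> i \<noteq> 5 \<longrightarrow> h i (\<gamma>' t) = h i (\<gamma> t))))"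
proof -
  obtain L where N: "negligible N" and L: "L-lipschitz_on {0..T} \<gamma>"
    and zero: "\<And>t. t \<in> {0..T} \<Longrightarrow> h 1 (\<gamma> t) = 0 \<and> h 2 (\<gamma> t) = 0 \<and> h 3 (\<gamma> t) = 0"
    and u: "\<And>t. t \<in> {0..T} - N \<Longrightarrow> u1 t \<noteq> 0 \<or> u2 t \<noteq> 0"
    and orth: "\<And>t. t \<in> {0..T} - N \<Longrightarrow> u1 t * h 4 (\<gamma> t) + u2 t * h 5 (\<gamma> t) = 0"
    and der: "\<And>t. t \<in> {0..T} - N \<Longrightarrow>
      (\<gamma> has_vector_derivative hamiltonian_field (u1 t) (u2 t) (\<gamma> t)) (at t within {0..T})"
    using sing unfolding singular_curve_def by blast
  define m6 m7 m8 where "m6 = h 6 (\<gamma> 0)" and "m7 = h 7 (\<gamma> 0)" and "m8 = h 8 (\<gamma> 0)"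
  have const: "h 6 (\<gamma> t) = m6" "h 7 (\<gamma> t) = m7" "h 8 (\<gamma> t) = m8" if "t \<in> {0..T}" for t
    using singular_curve_constants[OF sing that, of 0] that by (simp_all add: m6_def m7_def m8_def)
  define v where "v t = h 4 (\<gamma> t)" for t
  define w where "w t = h 5 (\<gamma> t)" for t
  have Lv: "L-lipschitz_on {0..T} v" and Lw: "L-lipschitz_on {0..T} w"
    unfolding v_def w_def by (rule h_lipschitz[OF L])+
  have vder: "(v has_real_derivative m6 * u1 t + m7 * u2 t) (at t within {0..T})"
    and wder: "(w has_real_derivative m7 * u1 t + m8 * u2 t) (at t within {0..T})"
    if t: "t \<in> {0..T} - N" for t
    using h_has_derivative(1)[OF der[OF t], of 4] h_has_derivative(1)[OF der[OF t], of 5] const[of t] t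
    by (simp_all add: v_def[abs_def] w_def[abs_def] h_hamiltonian_field mult.commute)

  have "negligible {t \<in> ?Z. \<not> t islimpt ?Z}"
    unfolding negligible_iff_null_sets
    by (intro null_sets_completionI countable_imp_null_set_lborel countable_isolated_points)
  with N have "negligible (N \<union> {t \<in> ?Z. \<not> t islimpt ?Z})" by simp
  then have "\<not> ?Z \<subseteq> N \<union> {t \<in> ?Z. \<not> t islimpt ?Z}" using Z negligible_subset by blast
  then obtain t0 where t0: "t0 \<in> ?Z" "t0 \<notin> N" "t0 islimpt ?Z" by blast
  define k1 k2 where "k1 = u1 t0" and "k2 = u2 t0"
  have k: "k1 \<noteq> 0 \<or> k2 \<noteq> 0" using u[of t0] t0 by (auto simp: k1_def k2_def)
  have t0': "t0 \<in> {0..T} - N" and sub: "?Z \<subseteq> {0..T}" using t0 by auto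
  have Mk: "m6 * k1 + m7 * k2 = 0" "m7 * k1 + m8 * k2 = 0"
    unfolding k1_def k2_def
    by (rule derivative_zero_at_limit_of_zeros[OF vder[OF t0'] sub t0(1,3)], simp add: v_def)
      (rule derivative_zero_at_limit_of_zeros[OF wder[OF t0'] sub t0(1,3)], simp add: w_def)
  have det: "m6 * m8 = m7 * m7"
  proof -
    have "(m6 * m8 - m7 * m7) * k1 = 0" "(m6 * m8 - m7 * m7) * k2 = 0" using Mk by algebra+
    then show ?thesis using k by auto
  qed

  define q where "q i t = snd (\<gamma> t) $ i - snd (\<gamma> t0) $ i" for i t
  have Lq: "L-lipschitz_on {0..T} (\<lambda>t. snd (\<gamma> t) $ i)" for i
    by (rule vec_nth_lipschitz[OF lipschitz_on_snd[OF L]])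
  have qder: "((\<lambda>t. snd (\<gamma> t) $ 1) has_real_derivative u1 t) (at t within {0..T})"
    "((\<lambda>t. snd (\<gamma> t) $ 2) has_real_derivative u2 t) (at t within {0..T})" if "t \<in> {0..T} - N" for t
    using h_has_derivative(2)[OF der[OF that]]
    unfolding has_vector_derivative_vec_componentwise h_hamiltonian_field
    by (metis horizontal_coordinates)+
  have affine: "f t = \<alpha> * q 1 t + \<beta> * q 2 t"
    if f: "L-lipschitz_on {0..T} f" "f t0 = 0"
      and fder: "\<And>t. t \<in> {0..T} - N \<Longrightarrow> (f has_real_derivative \<alpha> * u1 t + \<beta> * u2 t) (at t within {0..T})"
      and t: "t \<in> {0..T}" for f \<alpha> \<beta> t
  proof -
    define g where "g t = f t - (\<alpha> * snd (\<gamma> t) $ 1 + \<beta> * snd (\<gamma> t) $ 2)" for t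
    have "\<exists>M. M-lipschitz_on {0..T} g"
      unfolding g_def
      using lipschitz_on_diff[OF f(1) lipschitz_on_add[OF lipschitz_on_cmult_real[OF Lq]
            lipschitz_on_cmult_real[OF Lq]]] by blast
    moreover have "(g has_real_derivative 0) (at t within {0..T})" if "t \<in> {0..T} - N" for t
      unfolding g_def[abs_def] by (auto intro!: derivative_eq_intros fder qder that)
    ultimately have "g t = g t0"
      using lipschitz_ae_derivative_zero_constant[OF _ N _ t, of _ g t0] t0 by blast
    then show ?thesis using f(2) by (simp add: g_def q_def algebra_simps)
  qed
  have v: "v t = m6 * q 1 t + m7 * q 2 t" and w: "w t = m7 * q 1 t + m8 * q 2 t" if "t \<in> {0..T}" for t
    using affine[OF Lv _ vder that] affine[OF Lw _ wder that] t0 by (auto simp: v_def w_def)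
  define n where "n t = v t * v t + w t * w t" for t
  have "\<exists>M. M-lipschitz_on {0..T} n"
    unfolding n_def using lipschitz_on_mult_Icc[OF Lv Lv] lipschitz_on_mult_Icc[OF Lw Lw] lipschitz_on_add
    by blast
  moreover have "(n has_real_derivative 0) (at t within {0..T})" if t: "t \<in> {0..T} - N" for t
  proof -
    have "v t * (m6 * u1 t + m7 * u2 t) + w t * (m7 * u1 t + m8 * u2 t)
        = (m6 + m8) * (u1 t * v t + u2 t * w t)"
      using v[of t] w[of t] t det by auto algebra
    also have "\<dots> = 0" using orth[OF t] by (simp add: v_def w_def)
    finally have "v t * (m6 * u1 t + m7 * u2 t) + w t * (m7 * u1 t + m8 * u2 t) = 0" .
    then have "(m6 * u1 t + m7 * u2 t) * v t + (m6 * u1 t + m7 * u2 t) * v t +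
        ((m7 * u1 t + m8 * u2 t) * w t + (m7 * u1 t + m8 * u2 t) * w t) = 0" by algebra
    then show ?thesis
      unfolding n_def[abs_def]
      using DERIV_add[OF DERIV_mult[OF vder[OF t] vder[OF t]] DERIV_mult[OF wder[OF t] wder[OF t]]]
      by (simp add: algebra_simps)
  qed
  ultimately have "n t = n t0" if "t \<in> {0..T}" for t
    using lipschitz_ae_derivative_zero_constant[OF _ N _ that, of _ n t0] t0 by blast
  moreover have "n t0 = 0" using t0 by (simp add: n_def v_def w_def)
  ultimately have vw0: "v t = 0 \<and> w t = 0" if "t \<in> {0..T}" for t
    using that sum_squares_eq_zero_iff[of "v t" "w t"] by (simp add: n_def)

  have m0: "\<not> (m6 = 0 \<and> m7 = 0 \<and> m8 = 0)"
    using nontriv[of 0] zero[of 0] vw0[of 0] T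
    by (auto simp: m6_def m7_def m8_def v_def w_def vec_eq_8 h_def)
  have Mu: "m6 * u1 t + m7 * u2 t = 0" "m7 * u1 t + m8 * u2 t = 0" if t: "t \<in> {0..T} - N" for t
    using has_real_derivative_vanishing_Icc[OF vder[OF t] T] has_real_derivative_vanishing_Icc[OF wder[OF t] T]
      vw0 t by auto
  have par: "u1 t * k2 - u2 t * k1 = 0" if t: "t \<in> {0..T} - N" for t
  proof -
    have "(u1 t * k2 - u2 t * k1) * m6 = 0" "(u1 t * k2 - u2 t * k1) * m7 = 0"
      "(u1 t * k2 - u2 t * k1) * m8 = 0"
      using Mk Mu[OF t] by algebra+
    then show ?thesis using m0 by auto
  qed
  \<comment> \<open>The vector \<open>(k2, - k1)\<close> is orthogonal to the control and, as \<open>M (k1, k2) = 0\<close>, an equilibrium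
    of the linear system for \<open>(h 4, h 5)\<close>.\<close>
  define \<gamma>' :: "real \<Rightarrow> cotangent" where
    "\<gamma>' t = (vector [0, 0, 0, k2, - k1, m6, m7, m8], snd (\<gamma> t))" for t
  have h\<gamma>': "h 1 (\<gamma>' t) = 0" "h 2 (\<gamma>' t) = 0" "h 3 (\<gamma>' t) = 0" "h 4 (\<gamma>' t) = k2" "h 5 (\<gamma>' t) = - k1"
    "h 6 (\<gamma>' t) = m6" "h 7 (\<gamma>' t) = m7" "h 8 (\<gamma>' t) = m8" "snd (\<gamma>' t) = snd (\<gamma> t)" for t
    by (simp_all add: \<gamma>'_def h_def)
  have "singular_curve 0 T N u1 u2 \<gamma>'"
    unfolding singular_curve_def
  proof (intro conjI ballI)
    show "negligible N" by (rule N)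
    have "dist (\<gamma>' s) (\<gamma>' t) = dist (snd (\<gamma> s)) (snd (\<gamma> t))" for s t
      by (simp add: \<gamma>'_def dist_Pair_Pair)
    then show "\<exists>L. L-lipschitz_on {0..T} \<gamma>'"
      using lipschitz_on_snd[OF L] unfolding lipschitz_on_def by auto
    fix t assume t: "t \<in> {0..T} - N"
    show "u1 t \<noteq> 0 \<or> u2 t \<noteq> 0" by (rule u[OF t])
    show orth': "u1 t * h 4 (\<gamma>' t) + u2 t * h 5 (\<gamma>' t) = 0" using par[OF t] by (simp add: h\<gamma>')
    show "(\<gamma>' has_vector_derivative hamiltonian_field (u1 t) (u2 t) (\<gamma>' t)) (at t within {0..T})"
    proof (rule cotangent_has_vector_derivative)
      fix i :: 8
      have "h i (hamiltonian_field (u1 t) (u2 t) (\<gamma>' t)) = 0"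
        using exhaust_8[of i] orth' Mu[OF t]
        by (elim disjE) (simp_all add: h_hamiltonian_field h\<gamma>' mult.commute)
      moreover have "(\<lambda>t. h i (\<gamma>' t)) = (\<lambda>t. h i (\<gamma>' 0))" by (simp add: \<gamma>'_def h_def)
      ultimately show "((\<lambda>t. h i (\<gamma>' t)) has_real_derivative
          h i (hamiltonian_field (u1 t) (u2 t) (\<gamma>' t))) (at t within {0..T})" by simp
    next
      show "((\<lambda>t. snd (\<gamma>' t)) has_vector_derivative snd (hamiltonian_field (u1 t) (u2 t) (\<gamma>' t)))
          (at t within {0..T})"
        using h_has_derivative(2)[OF der[OF t]] by (simp add: h_hamiltonian_field h\<gamma>')
    qed
  qed (simp_all add: h\<gamma>')
  then have "reparameterized_reduced_curve 0 T \<gamma>'"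
    by (rule singular_curve_reparameterized[OF T]) (use k in \<open>auto simp: h\<gamma>'\<close>)
  moreover have "\<forall>t\<in>{0..T}. snd (\<gamma>' t) = snd (\<gamma> t) \<and>
      (\<forall>i. i \<noteq> 4 \<and> i \<noteq> 5 \<longrightarrow> h i (\<gamma>' t) = h i (\<gamma> t))"
  proof (intro ballI conjI allI impI)
    fix t and i :: 8 assume t: "t \<in> {0..T}" and "i \<noteq> 4 \<and> i \<noteq> 5"
    then show "h i (\<gamma>' t) = h i (\<gamma> t)"
      using exhaust_8[of i] zero[OF t] const[OF t] by (auto simp: h\<gamma>')
  qed (rule h\<gamma>'(9))
  moreover have "\<forall>t\<in>{0..T}. h 4 (\<gamma> t) = 0 \<and> h 5 (\<gamma> t) = 0"
    using vw0 by (simp add: v_def w_def)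
  ultimately show ?thesis by (intro conjI exI[of _ \<gamma>'])
qed

theorem proposition1:
  shows
    "(\<forall>T \<gamma>. abnormal_extremal T \<gamma> \<longrightarrow>
        (\<forall>t\<in>{0..T}. h 1 (\<gamma> t) = 0 \<and> h 2 (\<gamma> t) = 0 \<and> h 3 (\<gamma> t) = 0) \<and>
        (\<forall>s\<in>{0..T}. \<forall>t\<in>{0..T}.
           h 6 (\<gamma> s) = h 6 (\<gamma> t) \<and> h 7 (\<gamma> s) = h 7 (\<gamma> t) \<and> h 8 (\<gamma> s) = h 8 (\<gamma> t)) \<and>
        (\<forall>a b. 0 \<le> a \<and> a < b \<and> b \<le> T \<and> (\<forall>t\<in>{a..b}. \<not> (h 4 (\<gamma> t) = 0 \<and> h 5 (\<gamma> t) = 0)) \<longrightarrow>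
           reparameterized_reduced_curve a b \<gamma>) \<and>
        (negligible {t \<in> {0..T}. h 4 (\<gamma> t) = 0 \<and> h 5 (\<gamma> t) = 0} \<or>
         (\<forall>t\<in>{0..T}. h 4 (\<gamma> t) = 0 \<and> h 5 (\<gamma> t) = 0) \<and>
         (\<exists>\<gamma>'. reparameterized_reduced_curve 0 T \<gamma>' \<and>
            (\<forall>t\<in>{0..T}. snd (\<gamma>' t) = snd (\<gamma> t) \<and>
               (\<forall>i. i \<noteq> 4 \<and> i \<noteq> 5 \<longrightarrow> h i (\<gamma>' t) = h i (\<gamma> t)))))) \<and>
     (\<forall>T \<gamma>. 0 < T \<and> reparameterized_reduced_curve 0 T \<gamma> \<and>
        constant_velocity_trajectory T (\<lambda>t. snd (\<gamma> t)) \<longrightarrow> abnormal_extremal T \<gamma>)"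
proof (intro conjI allI impI)
  fix T \<gamma> assume ext: "abnormal_extremal T \<gamma>"
  then have T: "0 < T" and nontriv: "\<And>t. t \<in> {0..T} \<Longrightarrow> fst (\<gamma> t) \<noteq> 0"
    by (simp_all add: abnormal_extremal_def)
  obtain N u1 u2 where sing: "singular_curve 0 T N u1 u2 \<gamma>"
    using abnormal_extremal_imp_singular_curve[OF ext] .
  show "\<forall>t\<in>{0..T}. h 1 (\<gamma> t) = 0 \<and> h 2 (\<gamma> t) = 0 \<and> h 3 (\<gamma> t) = 0"
    using sing by (simp add: singular_curve_def)
  show "\<forall>s\<in>{0..T}. \<forall>t\<in>{0..T}.
      h 6 (\<gamma> s) = h 6 (\<gamma> t) \<and> h 7 (\<gamma> s) = h 7 (\<gamma> t) \<and> h 8 (\<gamma> s) = h 8 (\<gamma> t)"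
    using singular_curve_constants[OF sing] by blast
  show "reparameterized_reduced_curve a b \<gamma>"
    if "0 \<le> a \<and> a < b \<and> b \<le> T \<and> (\<forall>t\<in>{a..b}. \<not> (h 4 (\<gamma> t) = 0 \<and> h 5 (\<gamma> t) = 0))" for a b
    by (rule singular_curve_reparameterized[OF _ singular_curve_subinterval[OF sing]]) (use that in auto)
  show "negligible {t \<in> {0..T}. h 4 (\<gamma> t) = 0 \<and> h 5 (\<gamma> t) = 0} \<or>
      (\<forall>t\<in>{0..T}. h 4 (\<gamma> t) = 0 \<and> h 5 (\<gamma> t) = 0) \<and>
      (\<exists>\<gamma>'. reparameterized_reduced_curve 0 T \<gamma>' \<and>
         (\<forall>t\<in>{0..T}. snd (\<gamma>' t) = snd (\<gamma> t) \<and>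
            (\<forall>i. i \<noteq> 4 \<and> i \<noteq> 5 \<longrightarrow> h i (\<gamma>' t) = h i (\<gamma> t))))"
    using degenerate_singular_curve[OF T sing nontriv] by blast
qed (use reparameterized_imp_abnormal_extremal in blast)

end
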